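(* Assume that the homogeneous two-point problem \[ T_n[M]u(t)=0,\ t\in I,\qquad B_i(u)=0,\ i=1,\ldots,n, \] has $u=0$ as its unique solution, and let $g_M$ be its related Green's function. For $j\in\{1,\ldots,n\}$ let $\omega_j$ be the unique solution of \[ T_n[M]u(t)=0,\ t\in I,\qquad B_k(u)=0 \text{ for } k\neq j,\qquad B_j(u)=1 . \] Let $\sigma\in C(I)$ and $\delta_1,\ldots,\delta_n\in\mathbb{R}$ be such that \[ \det(I_n-A)\neq 0, \] where $I_n$ is the identity matrix of order $n$ and $A=(a_{ij})_{n\times n}$ is the $n\times n$ matrix given by $a_{ij}=\delta_j\,C_i(\omega_j)$, $i,j\in\{1,\ldots,n\}$. Then the problem \[ T_n[M]u(t)=\sigma(t),\ t\in I,\qquad B_i(u)=\delta_i\,C_i(u),\ i=1,\ldots,n, \] has a unique solution $u\in C^n(I)$, given by \[ u(t)=\int_a^b G(t,s,\delta_1,\ldots,\delta_n,M)\,\sigma(s)\,ds, \] where \[ G(t,s,\delta_1,\ldots,\delta_n,M):=g_M(t,s)+\sum_{i=1}^n\sum_{j=1}^n \delta_i\,b_{ij}\,\omega_i(t)\,C_j\bigl(g_M(\cdot,s)\bigr),\quad t,s\in I, \] and $B=(b_{ij})_{n\times n}=(I_n-A)^{-1}$.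
   Context: Let $n\ge 1$, $I=[a,b]$ a compact real interval, $M\in\mathbb{R}$, and let $a_1,\ldots,a_n$ be continuous real functions on $I$. For $u\in C^n(I)$ put \[ T_n[M]u(t)=u^{(n)}(t)+a_1(t)u^{(n-1)}(t)+\cdots+a_n(t)u(t)+M\,u(t),\quad t\in I. \] For $i=1,\ldots,n$ the two-point boundary operators are \[ B_i(u)=\sum_{j=0}^{n-1}\left(\alpha_j^i u^{(j)}(a)+\beta_j^i u^{(j)}(b)\right), \] with real constants $\alpha_j^i,\beta_j^i$. For $i=1,\ldots,n$, $C_i:C(I)\to\mathbb{R}$ is a linear continuous functional ($C(I)$ with the supremum norm). Solutions are functions in $C^n(I)$. When the homogeneous problem $T_n[M]u=0$, $B_i(u)=0$ ($i=1,\ldots,n$) has only the trivial solution, its Green's function $g_M:I\times I\to\mathbb{R}$ is the (unique) function such that: $g_M$ and its $t$-derivatives up to order $n-2$ are continuous on $I\times I$ (no condition if $n=1$); on each of the triangles $\{a\le s<t\le b\}$ and $\{a\le t<s\le b\}$, $g_M$ and its $t$-derivatives up to order $n$ exist, are continuous, extend continuously to the closed triangle, and satisfy $T_n[M]g_M(\cdot,s)=0$; for $s\in(a,b)$ the jump $\partial_t^{n-1}g_M(s^+,s)-\partial_t^{n-1}g_M(s^-,s)$ equals $1$; and $B_i(g_M(\cdot,s))=0$ for $s\in(a,b)$, $i=1,\ldots,n$. For every $\sigma\in C(I)$, $v(t)=\int_a^b g_M(t,s)\sigma(s)\,ds$ is the unique solution of $T_n[M]v=\sigma$, $B_i(v)=0$,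 $i=1,\ldots,n$. When this Green's function exists, the functions $\omega_j$ exist and are unique. Convention when $n=1$: $g_M$ has a jump on the diagonal $t=s$; its diagonal values are taken as the continuous extension from one (fixed) of the two triangles, and $C_j(g_M(\cdot,s))$ is understood by extending $C_j$ to bounded Borel functions via integration against its Riesz representing finite signed measure. For $n\ge 2$, $g_M(\cdot,s)\in C(I)$ and no convention is needed. *)

theory Defs
  imports "HOL-Analysis.Analysis"
begin

text \<open>Functions on \<open>I = {a..b}\<close> are total functions on the reals of which only the values on
  \<open>I\<close> matter. Derivatives are taken within the set, hence one-sided at the end points.\<close>

primrec nderiv :: "real set \<Rightarrow> nat \<Rightarrow> (real \<Rightarrow> real) \<Rightarrow> real \<Rightarrow> real" where
  "nderiv S 0 u = u"
| "nderiv S (Suc k) u = (\<lambda>t. vector_derivative (nderiv S k u) (at t within S))"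

definition Cn_on :: "nat \<Rightarrow> real set \<Rightarrow> (real \<Rightarrow> real) \<Rightarrow> bool" where
  "Cn_on n S u \<longleftrightarrow>
     (\<forall>k<n. \<forall>t\<in>S. nderiv S k u differentiable (at t within S)) \<and>
     continuous_on S (nderiv S n u)"

definition diff_op ::
  "nat \<Rightarrow> real \<Rightarrow> real \<Rightarrow> (nat \<Rightarrow> real \<Rightarrow> real) \<Rightarrow> real \<Rightarrow> (real \<Rightarrow> real) \<Rightarrow> real \<Rightarrow> real" where
  "diff_op n a b p M u t =
     nderiv {a..b} n u t + (\<Sum>i=1..n. p i t * nderiv {a..b} (n - i) u t) + M * u t"

definition bdry_op ::
  "nat \<Rightarrow> real \<Rightarrow> real \<Rightarrow> ('i \<Rightarrow> nat \<Rightarrow> real) \<Rightarrow> ('i \<Rightarrow> nat \<Rightarrow> real) \<Rightarrow> 'i \<Rightarrow> (real \<Rightarrow> real) \<Rightarrow> real" where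
  "bdry_op n a b \<alpha> \<beta> i u =
     (\<Sum>j<n. \<alpha> i j * nderiv {a..b} j u a + \<beta> i j * nderiv {a..b} j u b)"

definition solves ::
  "nat \<Rightarrow> real \<Rightarrow> real \<Rightarrow> (nat \<Rightarrow> real \<Rightarrow> real) \<Rightarrow> real \<Rightarrow>
   ('i \<Rightarrow> nat \<Rightarrow> real) \<Rightarrow> ('i \<Rightarrow> nat \<Rightarrow> real) \<Rightarrow>
   (real \<Rightarrow> real) \<Rightarrow> ('i \<Rightarrow> real) \<Rightarrow> (real \<Rightarrow> real) \<Rightarrow> bool" where
  "solves n a b p M \<alpha> \<beta> \<sigma> \<gamma> u \<longleftrightarrow>
     Cn_on n {a..b} u \<and>
     (\<forall>t\<in>{a..b}. diff_op n a b p M u t = \<sigma> t) \<and>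
     (\<forall>i. bdry_op n a b \<alpha> \<beta> i u = \<gamma> i)"

text \<open>Bounded linear functionals on \<open>C({a..b})\<close> with the supremum norm. That such a functional
  depends only on the values on \<open>{a..b}\<close> follows from linearity and the bound.\<close>

definition cont_lin_functional :: "real \<Rightarrow> real \<Rightarrow> ((real \<Rightarrow> real) \<Rightarrow> real) \<Rightarrow> bool" where
  "cont_lin_functional a b C \<longleftrightarrow>
     (\<forall>f h. continuous_on {a..b} f \<longrightarrow> continuous_on {a..b} h \<longrightarrow>
        C (\<lambda>t. f t + h t) = C f + C h) \<and>
     (\<forall>c f. continuous_on {a..b} f \<longrightarrow> C (\<lambda>t. c * f t) = c * C f) \<and>
     (\<exists>K. \<forall>f. continuous_on {a..b} f \<longrightarrow> \<bar>C f\<bar> \<le> K * (SUP t\<in>{a..b}. \<bar>f t\<bar>))"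

text \<open>The finite signed Borel measure on \<open>{a..b}\<close> representing \<open>C\<close> is given as a difference
  \<open>\<mu> - \<nu>\<close> of two finite measures.\<close>

definition represents ::
  "real \<Rightarrow> real \<Rightarrow> ((real \<Rightarrow> real) \<Rightarrow> real) \<Rightarrow> real measure \<times> real measure \<Rightarrow> bool" where
  "represents a b C = (\<lambda>(\<mu>, \<nu>).
     finite_measure \<mu> \<and> sets \<mu> = sets (restrict_space borel {a..b}) \<and>
     finite_measure \<nu> \<and> sets \<nu> = sets (restrict_space borel {a..b}) \<and>
     (\<forall>f. continuous_on {a..b} f \<longrightarrow> C f = (\<integral>x. f x \<partial>\<mu>) - (\<integral>x. f x \<partial>\<nu>)))"

text \<open>Extension of \<open>C\<close> to bounded Borel functions. The pair \<open>(\<mu>, \<nu>)\<close> is not unique but the signed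
  measure \<open>\<mu> - \<nu>\<close> is, so the choice does not affect the value. The second branch only matters for
  first-order problems, where \<open>g(\<cdot>, s)\<close> jumps at \<open>s\<close>.\<close>

definition borel_ext ::
  "real \<Rightarrow> real \<Rightarrow> ((real \<Rightarrow> real) \<Rightarrow> real) \<Rightarrow> (real \<Rightarrow> real) \<Rightarrow> real" where
  "borel_ext a b C h =
     (if continuous_on {a..b} h then C h
      else let (\<mu>, \<nu>) = (SOME r. represents a b C r) in (\<integral>x. h x \<partial>\<mu>) - (\<integral>x. h x \<partial>\<nu>))"

definition lower_tri :: "real \<Rightarrow> real \<Rightarrow> (real \<times> real) set" where
  "lower_tri a b = {(t, s). a \<le> s \<and> s \<le> t \<and> t \<le> b}"

definition upper_tri :: "real \<Rightarrow> real \<Rightarrow> (real \<times> real) set" where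
  "upper_tri a b = {(t, s). a \<le> t \<and> t \<le> s \<and> s \<le> b}"

text \<open>At \<open>t \<noteq> s\<close> the derivatives within \<open>{a..b}\<close> coincide with those within the section of the
  half-open triangle containing \<open>(t, s)\<close>. Having an extension \<open>h\<close> that is continuous on the closed
  triangle includes continuity on the half-open one. The clause for \<open>n = 1\<close> says that the diagonal
  values are the continuous extension from one and the same triangle.\<close>

definition is_green ::
  "nat \<Rightarrow> real \<Rightarrow> real \<Rightarrow> (nat \<Rightarrow> real \<Rightarrow> real) \<Rightarrow> real \<Rightarrow>
   ('i \<Rightarrow> nat \<Rightarrow> real) \<Rightarrow> ('i \<Rightarrow> nat \<Rightarrow> real) \<Rightarrow> (real \<Rightarrow> real \<Rightarrow> real) \<Rightarrow> bool" where
  "is_green n a b p M \<alpha> \<beta> g \<longleftrightarrow>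
     (n \<ge> 2 \<longrightarrow>
        (\<forall>s\<in>{a..b}. Cn_on (n - 2) {a..b} (\<lambda>t. g t s)) \<and>
        (\<forall>k\<le>n - 2. continuous_on ({a..b} \<times> {a..b})
           (\<lambda>(t, s). nderiv {a..b} k (\<lambda>x. g x s) t))) \<and>
     (n = 1 \<longrightarrow>
        continuous_on (lower_tri a b) (\<lambda>(t, s). g t s) \<or>
        continuous_on (upper_tri a b) (\<lambda>(t, s). g t s)) \<and>
     (\<forall>k<n. \<forall>s\<in>{a..b}. \<forall>t\<in>{a..b} - {s}.
        nderiv {a..b} k (\<lambda>x. g x s) differentiable (at t within {a..b})) \<and>
     (\<forall>k\<le>n. \<forall>\<Delta>\<in>{lower_tri a b, upper_tri a b}. \<exists>h.
        continuous_on \<Delta> h \<and>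
        (\<forall>(t, s)\<in>\<Delta>. t \<noteq> s \<longrightarrow> nderiv {a..b} k (\<lambda>x. g x s) t = h (t, s))) \<and>
     (\<forall>s\<in>{a..b}. \<forall>t\<in>{a..b} - {s}. diff_op n a b p M (\<lambda>x. g x s) t = 0) \<and>
     (\<forall>s\<in>{a<..<b}. \<exists>l r.
        (nderiv {a..b} (n - 1) (\<lambda>x. g x s) \<longlongrightarrow> r) (at_right s) \<and>
        (nderiv {a..b} (n - 1) (\<lambda>x. g x s) \<longlongrightarrow> l) (at_left s) \<and>
        r - l = 1) \<and>
     (\<forall>s\<in>{a<..<b}. \<forall>i. bdry_op n a b \<alpha> \<beta> i (\<lambda>x. g x s) = 0)"

definition coupling_matrix ::
  "real ^ 'n \<Rightarrow> ('n::finite \<Rightarrow> (real \<Rightarrow> real) \<Rightarrow> real) \<Rightarrow> ('n \<Rightarrow> real \<Rightarrow> real) \<Rightarrow> real ^ 'n ^ 'n" where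
  "coupling_matrix \<delta> C \<omega> = (\<chi> i j. \<delta> $ j * C i (\<omega> j))"

definition nonlocal_green ::
  "real \<Rightarrow> real \<Rightarrow> (real \<Rightarrow> real \<Rightarrow> real) \<Rightarrow> real ^ 'n \<Rightarrow>
   ('n::finite \<Rightarrow> (real \<Rightarrow> real) \<Rightarrow> real) \<Rightarrow> ('n \<Rightarrow> real \<Rightarrow> real) \<Rightarrow> real \<Rightarrow> real \<Rightarrow> real" where
  "nonlocal_green a b g \<delta> C \<omega> t s =
     g t s + (\<Sum>i\<in>UNIV. \<Sum>j\<in>UNIV.
       \<delta> $ i * matrix_inv (mat 1 - coupling_matrix \<delta> C \<omega>) $ i $ j *
       \<omega> i t * borel_ext a b (C j) (\<lambda>x. g x s))"

end

theory Submission
  imports Defs "HOL-Probability.Helly_Selection"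
begin

text \<open>Since the values \<open>C\<^sub>i(u)\<close> enter only as boundary data, a solution has the form
  \<open>u = v + \<Sum>\<^sub>i \<delta>\<^sub>i d\<^sub>i \<omega>\<^sub>i\<close> with \<open>v(t) = \<integral> g(t,s) \<sigma>(s) ds\<close>. Applying \<open>C\<^sub>i\<close> shows that
  \<open>d = (C\<^sub>i(u))\<^sub>i\<close> must satisfy \<open>(I - A) d = (C\<^sub>i(v))\<^sub>i\<close>, which has exactly one solution. The
  integral formula then amounts to \<open>C\<^sub>i(v) = \<integral> C\<^sub>i(g(\<cdot>,s)) \<sigma>(s) ds\<close>, which is Fubini's theorem once
  \<open>C\<^sub>i\<close> is represented by a signed measure. That \<open>v\<close> solves the problem with homogeneous boundary
  conditions is obtained without differentiating under the integral sign: integrating the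
  derivatives of \<open>g(\<cdot>,s)\<close> over \<open>[a,t]\<close> across the jump at \<open>s\<close> and interchanging the integrals yields
  \<open>v\<^sub>k(t) = v\<^sub>k(a) + \<integral>\<^bsub>[a,t]\<^esub> v\<^bsub>k+1\<^esub>\<close> for \<open>v\<^sub>k(t) = \<integral> \<partial>\<^sub>t\<^sup>k g(t,s) \<sigma>(s) ds\<close>, up to the extra term
  \<open>\<integral>\<^bsub>[a,t]\<^esub> \<sigma>\<close> for \<open>k = n - 1\<close>.\<close>

subsection \<open>Continuous linear functionals\<close>

lemma cont_lin_functional_add:
  "cont_lin_functional a b C \<Longrightarrow> continuous_on {a..b} f \<Longrightarrow> continuous_on {a..b} h \<Longrightarrow>
    C (\<lambda>t. f t + h t) = C f + C h"
  unfolding cont_lin_functional_def by blast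

lemma cont_lin_functional_scale:
  "cont_lin_functional a b C \<Longrightarrow> continuous_on {a..b} f \<Longrightarrow> C (\<lambda>t. c * f t) = c * C f"
  unfolding cont_lin_functional_def by blast

lemma cont_lin_functional_diff:
  assumes "cont_lin_functional a b C" "continuous_on {a..b} f" "continuous_on {a..b} h"
  shows "C (\<lambda>t. f t - h t) = C f - C h"
  using cont_lin_functional_add[OF assms(1,2), of "\<lambda>t. (-1) * h t"]
    cont_lin_functional_scale[OF assms(1,3), of "-1"] assms(3)
  by (simp add: continuous_on_minus)

lemma cont_lin_functional_sum:
  assumes "cont_lin_functional a b C" "finite A" "\<And>i. i \<in> A \<Longrightarrow> continuous_on {a..b} (f i)"
  shows "C (\<lambda>t. \<Sum>i\<in>A. c i * f i t) = (\<Sum>i\<in>A. c i * C (f i))"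
  using assms(2,3)
proof (induction A rule: finite_induct)
  case empty
  show ?case
    using cont_lin_functional_scale[OF assms(1), of "\<lambda>_. 0" 0] by simp
next
  case (insert i A)
  have "C (\<lambda>t. c i * f i t + (\<Sum>i\<in>A. c i * f i t)) = C (\<lambda>t. c i * f i t) + C (\<lambda>t. \<Sum>i\<in>A. c i * f i t)"
    using insert.prems
    by (intro cont_lin_functional_add[OF assms(1)] continuous_intros) auto
  then show ?case
    using insert cont_lin_functional_scale[OF assms(1), of "f i" "c i"] by simp
qed

text \<open>A pointwise bound \<open>B\<close> replaces the supremum, which is nonnegative because
  \<open>{a..b}\<close> is nonempty. Taking \<open>\<bar>K\<bar> + 1\<close> as the constant makes
  it strictly positive, so that later estimates and normalisations can divide by it.\<close>

lemma cont_lin_functional_bound: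
  assumes "a \<le> b" "cont_lin_functional a b C"
  obtains K where "K > 0"
    "\<And>f B. continuous_on {a..b} f \<Longrightarrow> (\<And>t. t \<in> {a..b} \<Longrightarrow> \<bar>f t\<bar> \<le> B) \<Longrightarrow> \<bar>C f\<bar> \<le> K * B"
proof -
  obtain K where K: "\<And>f. continuous_on {a..b} f \<Longrightarrow> \<bar>C f\<bar> \<le> K * (SUP t\<in>{a..b}. \<bar>f t\<bar>)"
    using assms(2) unfolding cont_lin_functional_def by blast
  have "\<bar>C f\<bar> \<le> (\<bar>K\<bar> + 1) * B"
    if f: "continuous_on {a..b} f" and B: "\<And>t. t \<in> {a..b} \<Longrightarrow> \<bar>f t\<bar> \<le> B" for f B
  proof -
    have le: "(SUP t\<in>{a..b}. \<bar>f t\<bar>) \<le> B"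
      using assms(1) B by (intro cSUP_least) auto
    have "\<bar>f a\<bar> \<le> (SUP t\<in>{a..b}. \<bar>f t\<bar>)"
      using assms(1) B by (intro cSUP_upper bdd_aboveI2) auto
    then have ge: "0 \<le> (SUP t\<in>{a..b}. \<bar>f t\<bar>)" by linarith
    have "\<bar>C f\<bar> \<le> K * (SUP t\<in>{a..b}. \<bar>f t\<bar>)" using K f by blast
    also have "\<dots> \<le> (\<bar>K\<bar> + 1) * (SUP t\<in>{a..b}. \<bar>f t\<bar>)"
      using ge by (intro mult_right_mono) auto
    also have "\<dots> \<le> (\<bar>K\<bar> + 1) * B"
      using le by (intro mult_left_mono) auto
    finally show ?thesis .
  qed
  then show ?thesis by (intro that[of "\<bar>K\<bar> + 1"]) auto
qed

text \<open>The difference \<open>f - h\<close> is bounded by 0 on \<open>{a..b}\<close>, so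
  \<open>C\<close> annihilates it. Needed because solutions are determined on the interval only,
  while \<open>C\<close> takes total functions.\<close>

lemma cont_lin_functional_cong:
  assumes "a \<le> b" "cont_lin_functional a b C" "continuous_on {a..b} f"
    "\<And>t. t \<in> {a..b} \<Longrightarrow> f t = h t"
  shows "C f = C h"
proof -
  obtain K where K: "\<And>f B. continuous_on {a..b} f \<Longrightarrow> (\<And>t. t \<in> {a..b} \<Longrightarrow> \<bar>f t\<bar> \<le> B) \<Longrightarrow> \<bar>C f\<bar> \<le> K * B"
    using cont_lin_functional_bound[OF assms(1,2)] by metis
  have h: "continuous_on {a..b} h"
    using assms(3) by (rule continuous_on_eq) (use assms(4) in auto)
  have "\<bar>C (\<lambda>t. f t - h t)\<bar> \<le> K * 0"
    using assms(3,4) h by (intro K continuous_intros) auto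
  then show ?thesis
    using cont_lin_functional_diff[OF assms(2,3) h] by simp
qed

subsection \<open>The Riesz representation on a compact interval\<close>

text \<open>The Bernstein polynomials turn \<open>C\<close> into discrete signed measures of bounded variation that
  converge to \<open>C\<close> pointwise; Helly's theorem provides a weak limit of the two parts.\<close>

lemma discrete_measures_weak_limit:
  fixes w x :: "nat \<Rightarrow> nat \<Rightarrow> real"
  assumes ab: "a \<le> b" and "K > 0" and fin: "\<And>m. finite (A m)"
    and nonneg: "\<And>m k. k \<in> A m \<Longrightarrow> 0 \<le> w m k" and total: "\<And>m. (\<Sum>k\<in>A m. w m k) = K"
    and x: "\<And>m k. k \<in> A m \<Longrightarrow> x m k \<in> {a..b}"
  obtains r \<mu> where "strict_mono (r :: nat \<Rightarrow> nat)" "finite_measure \<mu>"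
    "sets \<mu> = sets (restrict_space borel {a..b})"
    "\<And>f. continuous_on {a..b} f \<Longrightarrow>
      (\<lambda>m. \<Sum>k\<in>A (r m). w (r m) k * f (x (r m) k)) \<longlonglongrightarrow> (\<integral>t. f t \<partial>\<mu>)"
proof -
  \<comment> \<open>Dividing by the common total mass \<open>K\<close> gives probability measures,
    to which the selection theorem for tight sequences applies.\<close>
  define pm where "pm m = point_measure (A m) (\<lambda>k. ennreal (w m k / K))" for m
  define P where "P m = distr (pm m) borel (x m)" for m
  have xm [measurable]: "x m \<in> measurable (pm m) borel" for m
    by (simp add: pm_def)
  have prob_pm: "prob_space (pm m)" for m
  proof
    have "emeasure (pm m) (A m) = (\<Sum>k\<in>A m. ennreal (w m k / K))"
      unfolding pm_def using fin by (simp add: emeasure_point_measure_finite)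
    also have "\<dots> = ennreal (\<Sum>k\<in>A m. w m k / K)"
      using nonneg \<open>K > 0\<close> by (intro sum_ennreal) auto
    also have "(\<Sum>k\<in>A m. w m k / K) = 1"
      using total[of m] \<open>K > 0\<close> by (simp add: sum_divide_distrib [symmetric])
    finally show "emeasure (pm m) (space (pm m)) = 1"
      by (simp add: pm_def space_point_measure)
  qed
  have P: "real_distribution (P m)" for m
    unfolding P_def using prob_pm by (intro prob_space.real_distribution_distr) auto
  have intP: "(\<integral>y. f y \<partial>P m) = (\<Sum>k\<in>A m. w m k * f (x m k)) / K"
    if "f \<in> borel_measurable borel" for f :: "real \<Rightarrow> real" and m
    using that fin nonneg \<open>K > 0\<close> unfolding P_def
    by (subst integral_distr)
      (auto simp: pm_def lebesgue_integral_point_measure_finite sum_divide_distrib)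
  \<comment> \<open>Tightness is stated with half-open intervals; moving the left end to
    \<open>a - 1\<close> keeps an atom at \<open>a\<close> inside and the interval nonempty.\<close>
  have "measure (P m) {a - 1<..b} = 1" for m
  proof -
    have "measure (P m) {a - 1<..b} = measure (pm m) (x m -` {a - 1<..b} \<inter> space (pm m))"
      unfolding P_def by (rule measure_distr) auto
    also have "x m -` {a - 1<..b} \<inter> space (pm m) = space (pm m)"
      using x by (force simp: pm_def space_point_measure)
    finally show ?thesis
      using prob_space.prob_space[OF prob_pm] by simp
  qed
  then have "tight P"
    unfolding tight_def using P ab
    by (intro conjI allI impI exI[of _ "a - 1"] exI[of _ b]) auto
  then obtain r N where r: "strict_mono (r :: nat \<Rightarrow> nat)" and N: "real_distribution N"
    and conv: "weak_conv_m (P \<circ> id \<circ> r) N"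
    using tight_imp_convergent_subsubsequence[of P id] by (metis strict_mono_id)
  interpret N: real_distribution N by fact
  \<comment> \<open>The weak limit \<open>N\<close> lives on the whole line. The clamp onto
    \<open>{a..b}\<close> turns \<open>f\<close> into a bounded continuous function on the line and
    also pushes \<open>N\<close> forward to \<open>{a..b}\<close>.\<close>
  define cl where "cl y = max a (min b y)" for y
  have cl_in: "cl y \<in> {a..b}" for y using ab by (auto simp: cl_def)
  have cl_id: "y \<in> {a..b} \<Longrightarrow> cl y = y" for y by (auto simp: cl_def)
  have cont_cl: "continuous_on UNIV cl" unfolding cl_def by (intro continuous_intros)
  have cl_meas: "cl \<in> measurable N (restrict_space borel {a..b})"
    using cl_in borel_measurable_continuous_onI[OF cont_cl]
    by (intro measurable_restrict_space2) auto
  \<comment> \<open>The constant density \<open>K\<close> undoes the normalisation.\<close>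
  define \<mu> where "\<mu> = density (distr N (restrict_space borel {a..b}) cl) (\<lambda>_. ennreal K)"
  have "(\<lambda>m. \<Sum>k\<in>A (r m). w (r m) k * f (x (r m) k)) \<longlonglongrightarrow> (\<integral>t. f t \<partial>\<mu>)"
    if f: "continuous_on {a..b} f" for f
  proof -
    have cont: "continuous_on UNIV (\<lambda>y. f (cl y))"
      by (rule continuous_on_compose2[OF f cont_cl]) (use cl_in in auto)
    obtain B where B: "\<And>y. y \<in> {a..b} \<Longrightarrow> \<bar>f y\<bar> \<le> B"
      using compact_imp_bounded[OF compact_continuous_image[OF f compact_Icc]]
      unfolding bounded_iff by (metis imageI real_norm_def)
    have "(\<lambda>m. \<integral>y. f (cl y) \<partial>(P \<circ> id \<circ> r) m) \<longlonglongrightarrow> (\<integral>y. f (cl y) \<partial>N)"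
      using P N conv cont B cl_in
      by (intro weak_conv_imp_integral_bdd_continuous_conv[where B=B])
        (auto simp: continuous_on_eq_continuous_at o_def)
    moreover have "(\<integral>y. f (cl y) \<partial>(P \<circ> id \<circ> r) m) = (\<Sum>k\<in>A (r m). w (r m) k * f (x (r m) k)) / K" for m
      using intP[of "\<lambda>y. f (cl y)"] borel_measurable_continuous_onI[OF cont] cl_id x
      by simp
    ultimately have "(\<lambda>m. K * ((\<Sum>k\<in>A (r m). w (r m) k * f (x (r m) k)) / K)) \<longlonglongrightarrow> K * (\<integral>y. f (cl y) \<partial>N)"
      by (intro tendsto_mult_left) simp
    moreover have "(\<integral>t. f t \<partial>\<mu>) = K * (\<integral>y. f (cl y) \<partial>N)"
    proof -
      have fm: "f \<in> borel_measurable (restrict_space borel {a..b})"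
        using f by (rule borel_measurable_continuous_on_restrict)
      have "(\<integral>t. f t \<partial>\<mu>) = K * (\<integral>t. f t \<partial>distr N (restrict_space borel {a..b}) cl)"
        unfolding \<mu>_def using \<open>K > 0\<close> fm by (subst integral_density) auto
      also have "(\<integral>t. f t \<partial>distr N (restrict_space borel {a..b}) cl) = (\<integral>y. f (cl y) \<partial>N)"
        using cl_meas fm by (rule integral_distr)
      finally show ?thesis .
    qed
    ultimately show ?thesis using \<open>K > 0\<close> by simp
  qed
  moreover have "finite_measure \<mu>"
  proof
    have "emeasure (distr N (restrict_space borel {a..b}) cl) {a..b} \<noteq> \<infinity>"
      using cl_meas by (subst emeasure_distr) (auto simp: sets_restrict_space_iff)
    then show "emeasure \<mu> (space \<mu>) \<noteq> \<infinity>"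
      by (auto simp: \<mu>_def space_restrict_space emeasure_density_const sets_restrict_space_iff ennreal_mult_eq_top_iff)
  qed
  moreover have "sets \<mu> = sets (restrict_space borel {a..b})" by (simp add: \<mu>_def)
  ultimately show ?thesis using r that by blast
qed

text \<open>The Bernstein polynomials of \<open>f\<close>, transplanted to \<open>{a..b}\<close>,
  converge uniformly, and \<open>C\<close> respects uniform limits. By linearity \<open>C\<close> is
  thus a limit of combinations of point evaluations whose weights are its values on the Bernstein
  basis.\<close>

lemma Bernstein_Weierstrass_functional:
  assumes ab: "a < b" and C: "cont_lin_functional a b C" and f: "continuous_on {a..b} f"
  shows "(\<lambda>m. \<Sum>k\<le>m. C (\<lambda>t. Bernstein m k ((t - a) / (b - a))) * f (a + (b - a) * (k / m)))
    \<longlonglongrightarrow> C f"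
proof -
  have ab': "a \<le> b" using ab by simp
  obtain K where K: "K > 0"
    "\<And>f B. continuous_on {a..b} f \<Longrightarrow> (\<And>t. t \<in> {a..b} \<Longrightarrow> \<bar>f t\<bar> \<le> B) \<Longrightarrow> \<bar>C f\<bar> \<le> K * B"
    using cont_lin_functional_bound[OF ab' C] by metis
  define q where "q m k = (\<lambda>t. Bernstein m k ((t - a) / (b - a)))" for m k
  have q: "continuous_on {a..b} (q m k)" for m k
    unfolding q_def Bernstein_def using ab by (intro continuous_intros) auto
  have f1: "continuous_on {0..1} (\<lambda>y. f (a + (b - a) * y))"
  proof (rule continuous_on_compose2[OF f])
    show "(\<lambda>y. a + (b - a) * y) ` {0..1} \<subseteq> {a..b}"
    proof (rule image_subsetI)
      fix y :: real assume "y \<in> {0..1}"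
      then have "0 \<le> (b - a) * y" "(b - a) * y \<le> (b - a) * 1"
        using ab by (auto intro!: mult_nonneg_nonneg mult_left_mono)
      then show "a + (b - a) * y \<in> {a..b}" by simp
    qed
  qed (intro continuous_intros)
  show ?thesis
  proof (rule LIMSEQ_I)
    fix e :: real assume "e > 0"
    \<comment> \<open>The functional only transmits a weak inequality; the factor 2 leaves room for
      the strict one, since the bound becomes \<open>e / 2\<close>.\<close>
    then have "e / (2 * K) > 0" using K by simp
    from Bernstein_Weierstrass[OF f1 this] obtain N where N:
      "\<And>m y. m \<ge> N \<Longrightarrow> y \<in> {0..1} \<Longrightarrow>
        \<bar>f (a + (b - a) * y) - (\<Sum>k\<le>m. f (a + (b - a) * (k / m)) * Bernstein m k y)\<bar> < e / (2 * K)"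
      by blast
    have "norm ((\<Sum>k\<le>m. C (q m k) * f (a + (b - a) * (k / m))) - C f) < e" if m: "m \<ge> N" for m
    proof -
      let ?S = "\<lambda>t. \<Sum>k\<le>m. f (a + (b - a) * (k / m)) * q m k t"
      have "\<bar>f t - ?S t\<bar> \<le> e / (2 * K)" if "t \<in> {a..b}" for t
        using N[OF m, of "(t - a) / (b - a)"] that ab by (auto simp: q_def)
      moreover have S: "continuous_on {a..b} ?S" using q by (intro continuous_intros)
      ultimately have "\<bar>C (\<lambda>t. f t - ?S t)\<bar> \<le> K * (e / (2 * K))"
        using f by (intro K(2) continuous_on_diff) auto
      moreover have "C (\<lambda>t. f t - ?S t) = C f - (\<Sum>k\<le>m. f (a + (b - a) * (k / m)) * C (q m k))"
        using cont_lin_functional_diff[OF C f S] cont_lin_functional_sum[OF C, of "{..m}" "q m"] q by simp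
      ultimately show ?thesis using K \<open>e > 0\<close> by (simp add: mult.commute abs_minus_commute)
    qed
    then show "\<exists>N. \<forall>m\<ge>N. norm ((\<Sum>k\<le>m. C (\<lambda>t. Bernstein m k ((t - a) / (b - a))) * f (a + (b - a) * (k / m))) - C f) < e"
      unfolding q_def by blast
  qed
qed

text \<open>Ensures that the pair chosen by \<open>SOME\<close> in \<open>borel_ext\<close> really
  represents \<open>C\<close>.\<close>

theorem represents_exists:
  assumes ab: "a < b" and C: "cont_lin_functional a b C"
  shows "\<exists>r. represents a b C r"
proof -
  have ab': "a \<le> b" using ab by simp
  obtain K where K: "K > 0"
    "\<And>f B. continuous_on {a..b} f \<Longrightarrow> (\<And>t. t \<in> {a..b} \<Longrightarrow> \<bar>f t\<bar> \<le> B) \<Longrightarrow> \<bar>C f\<bar> \<le> K * B"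
    using cont_lin_functional_bound[OF ab' C] by metis
  define q where "q m k = (\<lambda>t. Bernstein m k ((t - a) / (b - a)))" for m k
  have q: "continuous_on {a..b} (q m k)" for m k
    unfolding q_def Bernstein_def using ab by (intro continuous_intros) auto
  define c where "c m k = C (q m k)" for m k
  have q_nonneg: "0 \<le> q m k t" if "t \<in> {a..b}" for m k t
    using that ab unfolding q_def by (intro Bernstein_nonneg) auto
  \<comment> \<open>Test \<open>C\<close> on the combination of the \<open>q m k\<close> with
    coefficients \<open>sgn (c m k)\<close>: the basis is nonnegative with sum 1, so this function
    is bounded by 1 on \<open>{a..b}\<close>.\<close>
  have abs_c: "(\<Sum>k\<le>m. \<bar>c m k\<bar>) \<le> K" for m
  proof -
    have "(\<Sum>k\<le>m. \<bar>c m k\<bar>) = (\<Sum>k\<le>m. sgn (c m k) * C (q m k))"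
      by (simp add: c_def abs_sgn mult.commute)
    also have "\<dots> = C (\<lambda>t. \<Sum>k\<le>m. sgn (c m k) * q m k t)"
      using cont_lin_functional_sum[OF C, of "{..m}" "q m"] q by simp
    also have "\<dots> \<le> K * 1"
    proof (rule order_trans[OF abs_ge_self K(2)])
      fix t assume t: "t \<in> {a..b}"
      have "\<bar>\<Sum>k\<le>m. sgn (c m k) * q m k t\<bar> \<le> (\<Sum>k\<le>m. q m k t)"
        using q_nonneg[OF t]
        by (intro order_trans[OF sum_abs] sum_mono) (auto simp: abs_mult sgn_if)
      also have "\<dots> = 1" by (simp add: q_def)
      finally show "\<bar>\<Sum>k\<le>m. sgn (c m k) * q m k t\<bar> \<le> 1" .
    qed (use q in \<open>intro continuous_intros\<close>)
    finally show ?thesis by simp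
  qed
  \<comment> \<open>The basis sums to 1, so the net mass does not depend on \<open>m\<close> and the
    masses of the positive and negative parts differ by a constant.\<close>
  have sum_c: "(\<Sum>k\<le>m. c m k) = C (\<lambda>_. 1)" for m
    using cont_lin_functional_sum[OF C, of "{..m}" "q m" "\<lambda>_. 1"] q by (simp add: c_def q_def)
  have "\<bar>C (\<lambda>_. 1)\<bar> \<le> K * 1" by (rule K) auto
  then have C1: "\<bar>C (\<lambda>_. 1)\<bar> \<le> K" by simp
  define S where "S m = (\<Sum>k\<le>m. max 0 (c m k))" for m
  have S: "S m \<le> K" for m
    unfolding S_def by (rule order_trans[OF sum_mono abs_c]) auto
  have S': "(\<Sum>k\<le>m. max 0 (- c m k)) = S m - C (\<lambda>_. 1)" for m
    unfolding S_def sum_c[of m, symmetric] sum_subtractf[symmetric] by (rule sum.cong) auto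
  (* The same extra atom at a is added to the positive and to the negative part: it cancels in the
     difference and makes the two total masses independent of m. *)
  define e where "e m = 2 * K - S m" for m
  have e: "e m \<ge> 0" for m using S[of m] K(1) by (simp add: e_def)
  \<comment> \<open>Index \<open>Suc m\<close> carries the extra atom, located at \<open>a\<close>.
    For \<open>m = 0\<close> the quotient \<open>0 / 0\<close> is 0, so the only Bernstein node is
    \<open>a\<close> as well.\<close>
  define x where "x m k = (if k \<le> m then a + (b - a) * (k / m) else a)" for m k :: nat
  define wp where "wp m k = (if k \<le> m then max 0 (c m k) else e m)" for m k :: nat
  define wn where "wn m k = (if k \<le> m then max 0 (- c m k) else e m)" for m k :: nat
  have x: "x m k \<in> {a..b}" for m k
  proof -
    have "0 \<le> (b - a) * (k / m)" "(b - a) * (k / m) \<le> (b - a) * 1" if "k \<le> m"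
      using ab that by (auto intro!: mult_left_mono simp del: mult_1_right simp: divide_le_eq)
    then show ?thesis using ab by (auto simp: x_def)
  qed
  have "(\<Sum>k\<le>Suc m. wp m k) = 2 * K" for m
    by (simp add: wp_def e_def S_def)
  moreover have "wp m k \<ge> 0" for m k using e by (simp add: wp_def)
  ultimately obtain r \<mu> where r: "strict_mono r" and mu: "finite_measure \<mu>"
    "sets \<mu> = sets (restrict_space borel {a..b})" and
    lim_mu: "\<And>f. continuous_on {a..b} f \<Longrightarrow>
      (\<lambda>m. \<Sum>k\<le>Suc (r m). wp (r m) k * f (x (r m) k)) \<longlonglongrightarrow> (\<integral>t. f t \<partial>\<mu>)"
    using ab' K(1) x
    by (elim discrete_measures_weak_limit[of a b "2 * K" "\<lambda>m. {..Suc m}" wp x, rotated -1])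
      (auto simp del: sum.atMost_Suc)
  have "(\<Sum>k\<le>Suc m. wn m k) = 2 * K - C (\<lambda>_. 1)" for m
    using S'[of m] by (simp add: wn_def e_def)
  moreover have "wn m k \<ge> 0" for m k using e by (simp add: wn_def)
  \<comment> \<open>Only \<open>\<bar>C (\<lambda>_. 1)\<bar> \<le> K\<close> is known, so a padding
    up to mass \<open>K\<close> might leave the negative part with mass 0; hence
    \<open>2 * K\<close> in \<open>e\<close>.\<close>
  moreover have "2 * K - C (\<lambda>_. 1) > 0" using C1 K(1) by linarith
  \<comment> \<open>The second limit is extracted from the subsequence \<open>r\<close> of the
    first, so both parts converge along \<open>r \<circ> r'\<close>.\<close>
  ultimately obtain r' \<nu> where r': "strict_mono r'" and nu: "finite_measure \<nu>"
    "sets \<nu> = sets (restrict_space borel {a..b})" and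
    lim_nu: "\<And>f. continuous_on {a..b} f \<Longrightarrow>
      (\<lambda>m. \<Sum>k\<le>Suc (r (r' m)). wn (r (r' m)) k * f (x (r (r' m)) k)) \<longlonglongrightarrow> (\<integral>t. f t \<partial>\<nu>)"
    using ab' x
    by (elim discrete_measures_weak_limit[of a b "2 * K - C (\<lambda>_. 1)" "\<lambda>m. {..Suc (r m)}"
        "\<lambda>m. wn (r m)" "\<lambda>m. x (r m)", rotated -1]) (auto simp del: sum.atMost_Suc)
  have "C f = (\<integral>t. f t \<partial>\<mu>) - (\<integral>t. f t \<partial>\<nu>)" if f: "continuous_on {a..b} f" for f
  proof (rule LIMSEQ_unique)
    have rr: "strict_mono (r \<circ> r')" using r r' by (rule strict_mono_o)
    show "(\<lambda>m. \<Sum>k\<le>r (r' m). c (r (r' m)) k * f (x (r (r' m)) k)) \<longlonglongrightarrow> C f"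
      using LIMSEQ_subseq_LIMSEQ[OF Bernstein_Weierstrass_functional[OF ab C f] rr]
      by (simp add: o_def c_def q_def x_def)
    have "(\<Sum>k\<le>m. c m k * f (x m k)) =
      (\<Sum>k\<le>Suc m. wp m k * f (x m k)) - (\<Sum>k\<le>Suc m. wn m k * f (x m k))" for m
    proof -
      have "(\<Sum>k\<le>m. c m k * f (x m k)) = (\<Sum>k\<le>m. wp m k * f (x m k) - wn m k * f (x m k))"
        by (rule sum.cong) (auto simp: wp_def wn_def max_def)
      then show ?thesis by (simp add: sum_subtractf wp_def wn_def)
    qed
    then show "(\<lambda>m. \<Sum>k\<le>r (r' m). c (r (r' m)) k * f (x (r (r' m)) k))
        \<longlonglongrightarrow> (\<integral>t. f t \<partial>\<mu>) - (\<integral>t. f t \<partial>\<nu>)"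
      using tendsto_diff[OF LIMSEQ_subseq_LIMSEQ[OF lim_mu[OF f] r'] lim_nu[OF f]]
      by (simp add: o_def del: sum.atMost_Suc)
  qed
  then have "represents a b C (\<mu>, \<nu>)"
    using mu nu unfolding represents_def by simp
  then show ?thesis ..
qed

subsection \<open>Iterated derivatives and linearity\<close>

text \<open>Derivatives within a nondegenerate interval are unique, so a chain \<open>V\<close> of
  successive derivatives starting at \<open>u\<close> must be the iterated derivatives. Later proofs
  exhibit such a chain instead of computing \<open>vector_derivative\<close>.\<close>

lemma nderiv_eqI:
  assumes "a < b"
    and "\<And>k t. k < n \<Longrightarrow> t \<in> {a..b} \<Longrightarrow>
      (V k has_vector_derivative V (Suc k) t) (at t within {a..b})"
    and "\<And>t. t \<in> {a..b} \<Longrightarrow> u t = V 0 t"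
    and "k \<le> n" "t \<in> {a..b}"
  shows "nderiv {a..b} k u t = V k t"
  using assms(4,5)
proof (induction k arbitrary: t)
  case 0
  then show ?case using assms(3) by simp
next
  case (Suc k)
  have "(nderiv {a..b} k u has_vector_derivative V (Suc k) t) (at t within {a..b})"
    using Suc by (intro has_vector_derivative_transform[OF _ _ assms(2)]) auto
  then show ?case
    using Suc.prems \<open>a < b\<close> by (simp add: vector_derivative_within_cbox[of a b, unfolded cbox_interval])
qed

lemma Cn_onI:
  assumes "a < b"
    and der: "\<And>k t. k < n \<Longrightarrow> t \<in> {a..b} \<Longrightarrow>
      (V k has_vector_derivative V (Suc k) t) (at t within {a..b})"
    and "continuous_on {a..b} (V n)"
    and "\<And>t. t \<in> {a..b} \<Longrightarrow> u t = V 0 t"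
  shows "Cn_on n {a..b} u"
proof -
  have eq: "nderiv {a..b} k u t = V k t" if "k \<le> n" "t \<in> {a..b}" for k t
    using nderiv_eqI[of a b n V u k t] assms that by blast
  have "nderiv {a..b} k u differentiable (at t within {a..b})" if "k < n" "t \<in> {a..b}" for k t
  proof -
    have "(nderiv {a..b} k u has_vector_derivative V (Suc k) t) (at t within {a..b})"
      using that eq by (intro has_vector_derivative_transform[OF _ _ der]) auto
    then show ?thesis by (rule differentiableI_vector)
  qed
  moreover have "continuous_on {a..b} (nderiv {a..b} n u)"
    using assms(3) by (rule continuous_on_eq) (use eq in auto)
  ultimately show ?thesis unfolding Cn_on_def by blast
qed

lemma Cn_on_has_vector_derivative:
  assumes "Cn_on n S u" "k < n" "t \<in> S"
  shows "(nderiv S k u has_vector_derivative nderiv S (Suc k) u t) (at t within S)"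
  using assms by (simp add: Cn_on_def vector_derivative_works)

lemma Cn_on_imp_continuous_on:
  assumes "Cn_on n S u"
  shows "continuous_on S u"
proof (cases "n = 0")
  case True
  then show ?thesis using assms by (simp add: Cn_on_def)
next
  case False
  then have "\<forall>t\<in>S. u differentiable (at t within S)"
    using assms unfolding Cn_on_def by (metis nderiv.simps(1) neq0_conv)
  then show ?thesis
    by (simp add: continuous_on_eq_continuous_within differentiable_imp_continuous_within)
qed

lemma Cn_on_lincomb:
  fixes c :: "'i \<Rightarrow> real"
  assumes "a < b" "Cn_on n {a..b} u" "\<And>i. i \<in> I \<Longrightarrow> Cn_on n {a..b} (w i)"
  shows "Cn_on n {a..b} (\<lambda>t. u t + (\<Sum>i\<in>I. c i * w i t))" (is "Cn_on n _ ?f")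
    and "\<And>k t. k \<le> n \<Longrightarrow> t \<in> {a..b} \<Longrightarrow>
      nderiv {a..b} k (\<lambda>t. u t + (\<Sum>i\<in>I. c i * w i t)) t =
      nderiv {a..b} k u t + (\<Sum>i\<in>I. c i * nderiv {a..b} k (w i) t)"
proof -
  define V where "V k t = nderiv {a..b} k u t + (\<Sum>i\<in>I. c i * nderiv {a..b} k (w i) t)" for k t
  have der: "(V k has_vector_derivative V (Suc k) t) (at t within {a..b})"
    if "k < n" "t \<in> {a..b}" for k t
    unfolding V_def
    using Cn_on_has_vector_derivative[OF assms(2) that] Cn_on_has_vector_derivative[OF assms(3) that]
    by (intro has_vector_derivative_add has_vector_derivative_sum has_vector_derivative_mult_right)
  have "continuous_on {a..b} (V n)"
    unfolding V_def using assms(2,3) by (intro continuous_intros) (auto simp: Cn_on_def)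
  then show "Cn_on n {a..b} ?f"
    using assms(1) der by (intro Cn_onI[of a b n V]) (auto simp: V_def)
  show "nderiv {a..b} k ?f t = nderiv {a..b} k u t + (\<Sum>i\<in>I. c i * nderiv {a..b} k (w i) t)"
    if "k \<le> n" "t \<in> {a..b}" for k t
    using nderiv_eqI[of a b n V ?f k t] assms(1) der that by (simp add: V_def)
qed

text \<open>Superposition, for the equation and the boundary data at once. One leading term plus a
  finite sum covers all uses: correcting a solution by the functions \<open>\<omega> i\<close>, and
  subtracting two solutions.\<close>

lemma solves_lincomb:
  fixes c :: "'i \<Rightarrow> real"
  assumes ab: "a < b" and u: "solves n a b p M \<alpha> \<beta> \<sigma> \<gamma> u"
    and w: "\<And>i. i \<in> I \<Longrightarrow> solves n a b p M \<alpha> \<beta> (\<tau> i) (\<eta> i) (w i)"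
  shows "solves n a b p M \<alpha> \<beta> (\<lambda>t. \<sigma> t + (\<Sum>i\<in>I. c i * \<tau> i t))
    (\<lambda>k. \<gamma> k + (\<Sum>i\<in>I. c i * \<eta> i k)) (\<lambda>t. u t + (\<Sum>i\<in>I. c i * w i t))"
proof -
  let ?f = "\<lambda>t. u t + (\<Sum>i\<in>I. c i * w i t)"
  have Cn: "Cn_on n {a..b} u" "\<And>i. i \<in> I \<Longrightarrow> Cn_on n {a..b} (w i)"
    using u w unfolding solves_def by auto
  note lin = Cn_on_lincomb[OF ab Cn, where I = I and c = c]
  have "diff_op n a b p M ?f t = \<sigma> t + (\<Sum>i\<in>I. c i * \<tau> i t)" if t: "t \<in> {a..b}" for t
  proof -
    have "diff_op n a b p M ?f t = diff_op n a b p M u t + (\<Sum>i\<in>I. c i * diff_op n a b p M (w i) t)"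
      unfolding diff_op_def using lin(2) t
      by (simp add: sum.distrib sum_distrib_left algebra_simps sum.swap[of _ "{Suc 0..n}" I])
    then show ?thesis using u w t by (simp add: solves_def)
  qed
  moreover have "bdry_op n a b \<alpha> \<beta> k ?f = \<gamma> k + (\<Sum>i\<in>I. c i * \<eta> i k)" for k
  proof -
    have "bdry_op n a b \<alpha> \<beta> k ?f = bdry_op n a b \<alpha> \<beta> k u + (\<Sum>i\<in>I. c i * bdry_op n a b \<alpha> \<beta> k (w i))"
      unfolding bdry_op_def using lin(2) ab
      by (simp add: sum.distrib sum_distrib_left algebra_simps sum.swap[of _ "{..<n}" I])
    then show ?thesis using u w by (simp add: solves_def)
  qed
  ultimately show ?thesis using lin(1) by (simp add: solves_def)
qed

subsection \<open>Kernels on a square\<close>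

lemma closed_lower_tri: "closed (lower_tri a b)"
  and closed_upper_tri: "closed (upper_tri a b)"
  unfolding lower_tri_def upper_tri_def case_prod_beta
  by (intro closed_Collect_conj closed_Collect_le continuous_intros)+

lemma compact_lower_tri: "compact (lower_tri a b)"
  and compact_upper_tri: "compact (upper_tri a b)"
proof -
  have "bounded ({a..b} \<times> {a..b})" by (intro bounded_Times) auto
  then have "bounded (lower_tri a b)" "bounded (upper_tri a b)"
    by (auto elim!: bounded_subset simp: lower_tri_def upper_tri_def)
  then show "compact (lower_tri a b)" "compact (upper_tri a b)"
    using closed_lower_tri closed_upper_tri by (auto simp: compact_eq_bounded_closed)
qed

text \<open>Compactness of the two pieces yields both measurability and boundedness. On the overlap
  \<open>S\<close> has precedence, so the caller decides which triangle owns the diagonal.\<close>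

lemma borel_measurable_bounded_piecewise:
  fixes f h h' :: "'a::euclidean_space \<Rightarrow> real"
  assumes "compact S" "compact T" "continuous_on S h" "continuous_on T h'"
    and "\<And>x. x \<in> S \<Longrightarrow> f x = h x" "\<And>x. x \<in> T - S \<Longrightarrow> f x = h' x" "\<And>x. x \<notin> S \<union> T \<Longrightarrow> f x = 0"
  shows "f \<in> borel_measurable borel" "\<exists>B. \<forall>x. \<bar>f x\<bar> \<le> B"
proof -
  have [measurable]: "S \<in> sets borel" "T \<in> sets borel"
    using assms(1,2) by (auto simp: borel_compact)
  have [measurable]: "(\<lambda>x. indicator S x *\<^sub>R h x) \<in> borel_measurable borel"
    "(\<lambda>x. indicator T x *\<^sub>R h' x) \<in> borel_measurable borel"
    using assms(1-4) by (auto intro!: borel_measurable_continuous_on_indicator borel_compact simp del: real_scaleR_def)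
  have "f = (\<lambda>x. if x \<in> S then indicator S x *\<^sub>R h x else indicator T x *\<^sub>R h' x)"
    using assms(5-7) by (auto simp: indicator_def fun_eq_iff)
  then show "f \<in> borel_measurable borel" by simp
  obtain B B' where "\<And>x. x \<in> S \<Longrightarrow> \<bar>h x\<bar> \<le> B" "\<And>x. x \<in> T \<Longrightarrow> \<bar>h' x\<bar> \<le> B'"
    using compact_imp_bounded[OF compact_continuous_image[OF assms(3,1)]]
      compact_imp_bounded[OF compact_continuous_image[OF assms(4,2)]]
    unfolding bounded_iff by auto
  then have "\<bar>f x\<bar> \<le> max 0 (max B B')" for x
    using assms(5-7) by (cases "x \<in> S"; cases "x \<in> T") (auto simp: le_max_iff_disj)
  then show "\<exists>B. \<forall>x. \<bar>f x\<bar> \<le> B" by blast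
qed

section \<open>Integrability and Fubini's theorem for bounded kernels\<close>

lemma integrable_pair_bounded:
  fixes f :: "'a \<Rightarrow> 'b \<Rightarrow> real"
  assumes "sigma_finite_measure M2"
    and "A1 \<in> sets M1" "emeasure M1 A1 < \<infinity>" "A2 \<in> sets M2" "emeasure M2 A2 < \<infinity>"
    and "case_prod f \<in> borel_measurable (M1 \<Otimes>\<^sub>M M2)"
    and "\<And>x y. \<bar>f x y\<bar> \<le> B" "\<And>x y. x \<notin> A1 \<or> y \<notin> A2 \<Longrightarrow> f x y = 0"
  shows "integrable (M1 \<Otimes>\<^sub>M M2) (case_prod f)"
proof (rule integrableI_bounded_set[where A = "A1 \<times> A2" and B = B])
  show "AE x in M1 \<Otimes>\<^sub>M M2. x \<notin> A1 \<times> A2 \<longrightarrow> case_prod f x = 0"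
    using assms(8) by (intro AE_I2) auto
  show "emeasure (M1 \<Otimes>\<^sub>M M2) (A1 \<times> A2) < \<infinity>"
    using assms(2-5) by (simp add: sigma_finite_measure.emeasure_pair_measure_Times[OF assms(1)]
        ennreal_mult_less_top)
qed (use assms(2-8) in auto)

text \<open>Extension by zero outside the square lets all integrals run over the whole line, with a
  support of finite product measure.\<close>

definition bounded_kernel :: "real \<Rightarrow> real \<Rightarrow> (real \<Rightarrow> real \<Rightarrow> real) \<Rightarrow> bool" where
  "bounded_kernel a b K \<longleftrightarrow> case_prod K \<in> borel_measurable borel \<and>
     (\<exists>B. \<forall>t s. \<bar>K t s\<bar> \<le> B) \<and> (\<forall>t s. t \<notin> {a..b} \<or> s \<notin> {a..b} \<longrightarrow> K t s = 0)"

lemma bounded_kernel_sections: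
  assumes "bounded_kernel a b K"
  shows "K t \<in> borel_measurable borel" "(\<lambda>t. K t s) \<in> borel_measurable borel"
proof -
  have K: "case_prod K \<in> borel_measurable borel" using assms by (simp add: bounded_kernel_def)
  have "(\<lambda>s. (t, s)) \<in> borel_measurable borel" "(\<lambda>t. (t, s)) \<in> borel_measurable borel"
    by (intro borel_measurable_continuous_onI continuous_intros)+
  from this[THEN measurable_compose, OF K]
  show "K t \<in> borel_measurable borel" "(\<lambda>t. K t s) \<in> borel_measurable borel" by simp_all
qed

lemma bounded_kernel_slice_integrable:
  assumes K: "bounded_kernel a b K" and S: "integrable lborel S"
  shows "integrable lborel (\<lambda>s. K t s * S s)"
proof -
  obtain B where B: "\<And>t s. \<bar>K t s\<bar> \<le> B"
    using K unfolding bounded_kernel_def by blast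
  show ?thesis
  proof (rule Bochner_Integration.integrable_bound)
    show "integrable lborel (\<lambda>s. B * S s)" using S by simp
    show "AE s in lborel. norm (K t s * S s) \<le> norm (B * S s)"
    proof (rule AE_I2)
      fix s
      have "\<bar>K t s\<bar> \<le> \<bar>B\<bar>" using B[of t s] by linarith
      then show "norm (K t s * S s) \<le> norm (B * S s)"
        by (simp add: abs_mult mult_right_mono)
    qed
    show "(\<lambda>s. K t s * S s) \<in> borel_measurable lborel"
      using bounded_kernel_sections(1)[OF K] S by (intro borel_measurable_times) auto
  qed
qed

text \<open>The measure \<open>N\<close> is kept general for two uses: \<open>lborel\<close> with
  \<open>A = {a..t}\<close>, to integrate a derivative kernel in its first variable, and a finite
  measure representing part of a functional, with \<open>A = {a..b}\<close>.\<close>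

lemma bounded_kernel_Fubini:
  assumes fin: "sigma_finite_measure N" "sets N = sets borel" "emeasure N {a..b} < \<infinity>"
    and K: "bounded_kernel a b K"
    and S: "S \<in> borel_measurable borel" "\<And>s. \<bar>S s\<bar> \<le> D"
    and A: "A \<in> sets borel"
  shows "integrable lborel (\<lambda>s. (\<integral>t. indicator A t * K t s \<partial>N) * S s)"
    and "(\<integral>s. (\<integral>t. indicator A t * K t s \<partial>N) * S s \<partial>lborel) =
      (\<integral>t. indicator A t * (\<integral>s. K t s * S s \<partial>lborel) \<partial>N)"
proof -
  let ?f = "\<lambda>t s. indicator A t * (K t s * S s)"
  obtain B where B: "\<And>t s. \<bar>K t s\<bar> \<le> B"
    using K unfolding bounded_kernel_def by blast
  interpret N: sigma_finite_measure N by fact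
  interpret pair_sigma_finite N lborel ..
  have sets_eq: "sets (N \<Otimes>\<^sub>M lborel) = sets (borel \<Otimes>\<^sub>M borel)"
    using fin(2) by (intro sets_pair_measure_cong) auto
  have int: "integrable (N \<Otimes>\<^sub>M lborel) (case_prod ?f)"
  proof (rule integrable_pair_bounded)
    show "case_prod ?f \<in> borel_measurable (N \<Otimes>\<^sub>M lborel)"
    proof -
      have [measurable]: "case_prod K \<in> borel_measurable (borel \<Otimes>\<^sub>M borel)"
        unfolding borel_prod using K by (simp add: bounded_kernel_def)
      have "case_prod ?f = (\<lambda>x. indicator A (fst x) * (case_prod K x * S (snd x)))"
        by (auto simp: fun_eq_iff)
      also have "\<dots> \<in> borel_measurable (borel \<Otimes>\<^sub>M borel)"
        using S(1) A by measurable
      finally show ?thesis by (subst measurable_cong_sets[OF sets_eq refl])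
    qed
    show "\<bar>?f t s\<bar> \<le> B * D" for t s
    proof -
      have "\<bar>K t s\<bar> * \<bar>S s\<bar> \<le> B * D"
        using B[of t s] S(2)[of s] by (intro mult_mono) linarith+
      moreover have "0 \<le> \<bar>K t s\<bar> * \<bar>S s\<bar>" by simp
      ultimately have "0 \<le> B * D" by linarith
      with \<open>\<bar>K t s\<bar> * \<bar>S s\<bar> \<le> B * D\<close> show ?thesis
        by (simp add: abs_mult indicator_def)
    qed
    show "?f t s = 0" if "t \<notin> {a..b} \<or> s \<notin> {a..b}" for t s
      using that K by (simp add: bounded_kernel_def)
    show "emeasure lborel {a..b} < \<infinity>" by (cases "a \<le> b") auto
  qed (use fin in \<open>auto intro: lborel.sigma_finite_measure_axioms\<close>)
  have eq: "(\<integral>t. ?f t s \<partial>N) = (\<integral>t. indicator A t * K t s \<partial>N) * S s" for s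
    by (simp flip: mult.assoc)
  have eq': "(\<integral>s. ?f t s \<partial>lborel) = indicator A t * (\<integral>s. K t s * S s \<partial>lborel)" for t
    by simp
  show "integrable lborel (\<lambda>s. (\<integral>t. indicator A t * K t s \<partial>N) * S s)"
    using integrable_snd[OF int] unfolding eq .
  show "(\<integral>s. (\<integral>t. indicator A t * K t s \<partial>N) * S s \<partial>lborel) =
      (\<integral>t. indicator A t * (\<integral>s. K t s * S s \<partial>lborel) \<partial>N)"
    using Fubini_integral[OF int] unfolding eq eq' .
qed

section \<open>Kernels that are continuous on each closed triangle\<close>

text \<open>The diagonal lies in both triangles; the lower branch takes precedence there. For fixed
  \<open>t\<close> this concerns the single point \<open>s = t\<close>, which Lebesgue integrals in
  \<open>s\<close> do not see.\<close>

definition tri_kernel ::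
  "real \<Rightarrow> real \<Rightarrow> (real \<times> real \<Rightarrow> real) \<Rightarrow> (real \<times> real \<Rightarrow> real) \<Rightarrow> real \<Rightarrow> real \<Rightarrow> real" where
  "tri_kernel a b h h' t s =
     (if (t, s) \<in> lower_tri a b then h (t, s)
      else if (t, s) \<in> upper_tri a b then h' (t, s) else 0)"

lemma bounded_kernel_piecewise:
  assumes ST: "compact S" "compact T" "S \<union> T \<subseteq> {a..b} \<times> {a..b}"
    and "continuous_on S h" "continuous_on T h'"
    and "\<And>t s. (t, s) \<in> S \<Longrightarrow> K t s = h (t, s)" "\<And>t s. (t, s) \<in> T - S \<Longrightarrow> K t s = h' (t, s)"
    and zero: "\<And>t s. (t, s) \<notin> S \<union> T \<Longrightarrow> K t s = 0"
  shows "bounded_kernel a b K"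
proof -
  have eq: "case_prod K x = h x" if "x \<in> S" for x using that assms(6) by (cases x) simp
  have eq': "case_prod K x = h' x" if "x \<in> T - S" for x using that assms(7) by (cases x) simp
  have eq0: "case_prod K x = 0" if "x \<notin> S \<union> T" for x using that zero by (cases x) simp
  note mb = borel_measurable_bounded_piecewise[OF ST(1,2) assms(4,5) eq eq' eq0]
  have "K t s = 0" if "t \<notin> {a..b} \<or> s \<notin> {a..b}" for t s
    using that ST(3) by (intro zero) auto
  then show ?thesis using mb by (simp add: bounded_kernel_def)
qed

lemma bounded_kernel_tri_kernel:
  assumes "continuous_on (lower_tri a b) h" "continuous_on (upper_tri a b) h'"
  shows "bounded_kernel a b (tri_kernel a b h h')"
proof (rule bounded_kernel_piecewise[OF compact_lower_tri compact_upper_tri _ assms])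
  show "lower_tri a b \<union> upper_tri a b \<subseteq> {a..b} \<times> {a..b}"
    by (auto simp: lower_tri_def upper_tri_def)
qed (simp_all add: tri_kernel_def)

text \<open>Off the diagonal the approximating points eventually lie in the same triangle as the
  limit point, and the branch there is continuous.\<close>

lemma tri_kernel_tendsto:
  assumes h: "continuous_on (lower_tri a b) h" "continuous_on (upper_tri a b) h'"
    and x: "\<And>m. x m \<in> {a..b}" "x \<longlonglongrightarrow> t" and ts: "t \<in> {a..b}" "s \<in> {a..b}" "t \<noteq> s"
  shows "(\<lambda>m. tri_kernel a b h h' (x m) s) \<longlonglongrightarrow> tri_kernel a b h h' t s"
proof -
  have lim: "(\<lambda>m. (x m, s)) \<longlonglongrightarrow> (t, s)" using x(2) by (intro tendsto_intros)
  consider "s < t" | "t < s" using ts(3) by linarith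
  then show ?thesis
  proof cases
    case 1
    have ev: "\<forall>\<^sub>F m in sequentially. (x m, s) \<in> lower_tri a b"
      using order_tendstoD(1)[OF x(2) 1] by (rule eventually_mono) (use x(1) ts in \<open>auto simp: lower_tri_def\<close>)
    have "(\<lambda>m. h (x m, s)) \<longlonglongrightarrow> h (t, s)"
      using 1 ts by (intro continuous_on_tendsto_compose[OF h(1) lim _ ev]) (auto simp: lower_tri_def)
    moreover have "\<forall>\<^sub>F m in sequentially. h (x m, s) = tri_kernel a b h h' (x m) s"
      using ev by (rule eventually_mono) (auto simp: tri_kernel_def)
    moreover have "tri_kernel a b h h' t s = h (t, s)"
      using 1 ts by (auto simp: tri_kernel_def lower_tri_def)
    ultimately show ?thesis by (simp add: Lim_transform_eventually)
  next
    case 2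
    have ev: "\<forall>\<^sub>F m in sequentially. (x m, s) \<in> upper_tri a b - lower_tri a b"
      using order_tendstoD(2)[OF x(2) 2]
      by (rule eventually_mono) (use x(1) ts in \<open>auto simp: lower_tri_def upper_tri_def\<close>)
    then have ev': "\<forall>\<^sub>F m in sequentially. (x m, s) \<in> upper_tri a b"
      by (rule eventually_mono) auto
    have "(\<lambda>m. h' (x m, s)) \<longlonglongrightarrow> h' (t, s)"
      using 2 ts by (intro continuous_on_tendsto_compose[OF h(2) lim _ ev']) (auto simp: upper_tri_def)
    moreover have "\<forall>\<^sub>F m in sequentially. h' (x m, s) = tri_kernel a b h h' (x m) s"
      using ev by (rule eventually_mono) (auto simp: tri_kernel_def)
    moreover have "tri_kernel a b h h' t s = h' (t, s)"
      using 2 ts by (auto simp: tri_kernel_def lower_tri_def upper_tri_def)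
    ultimately show ?thesis by (simp add: Lim_transform_eventually)
  qed
qed

text \<open>Dominated convergence: the integrands converge for every \<open>s\<close> other than
  \<open>t\<close>, hence almost everywhere, and the kernel is bounded.\<close>

lemma tri_kernel_integral_continuous_on:
  assumes h: "continuous_on (lower_tri a b) h" "continuous_on (upper_tri a b) h'"
    and S: "integrable lborel S" "\<And>s. s \<notin> {a..b} \<Longrightarrow> S s = 0"
  shows "continuous_on {a..b} (\<lambda>t. \<integral>s. tri_kernel a b h h' t s * S s \<partial>lborel)"
  unfolding continuous_on_sequentially
proof (intro allI ballI impI)
  fix x :: "nat \<Rightarrow> real" and t assume t: "t \<in> {a..b}" and x: "(\<forall>m. x m \<in> {a..b}) \<and> x \<longlonglongrightarrow> t"
  obtain B where B: "\<And>t s. \<bar>tri_kernel a b h h' t s\<bar> \<le> B"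
    using bounded_kernel_tri_kernel[OF h] unfolding bounded_kernel_def by blast
  have "(\<lambda>m. \<integral>s. tri_kernel a b h h' (x m) s * S s \<partial>lborel) \<longlonglongrightarrow>
      (\<integral>s. tri_kernel a b h h' t s * S s \<partial>lborel)"
  proof (rule integral_dominated_convergence[where w = "\<lambda>s. B * \<bar>S s\<bar>"])
    show "integrable lborel (\<lambda>s. B * \<bar>S s\<bar>)" using S(1) by simp
    show "AE s in lborel. (\<lambda>m. tri_kernel a b h h' (x m) s * S s) \<longlonglongrightarrow> tri_kernel a b h h' t s * S s"
      using AE_lborel_singleton[of t]
    proof eventually_elim
      case (elim s)
      show ?case
      proof (cases "s \<in> {a..b}")
        case True
        then show ?thesis
          using elim t x by (intro tendsto_mult_right tri_kernel_tendsto[OF h]) auto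
      qed (simp add: S(2))
    qed
    show "AE s in lborel. norm (tri_kernel a b h h' (x m) s * S s) \<le> B * \<bar>S s\<bar>" for m
      using B by (intro AE_I2) (simp add: abs_mult mult_right_mono)
  qed (intro borel_measurable_integrable bounded_kernel_slice_integrable[OF bounded_kernel_tri_kernel[OF h] S(1)])+
  then show "((\<lambda>t. \<integral>s. tri_kernel a b h h' t s * S s \<partial>lborel) \<circ> x) \<longlonglongrightarrow>
      (\<integral>s. tri_kernel a b h h' t s * S s \<partial>lborel)"
    by (simp add: o_def)
qed

section \<open>Integrating and differentiating across the diagonal jump\<close>

text \<open>The fundamental theorem is applied on either side of \<open>s\<close> to the continuous
  extensions \<open>L\<close> and \<open>R\<close>. When the interval crosses \<open>s\<close>, the
  two increments add up to that of \<open>F\<close> less the jump \<open>R s - L s\<close>.\<close>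

lemma has_integral_derivative_jump:
  fixes F F' L R :: "real \<Rightarrow> real"
  assumes s: "s \<in> {a<..<b}"
    and der: "\<And>t. t \<in> {a..b} - {s} \<Longrightarrow> (F has_vector_derivative F' t) (at t within {a..b})"
    and R: "continuous_on {s..b} R" "\<And>t. t \<in> {s<..b} \<Longrightarrow> F t = R t"
    and L: "continuous_on {a..s} L" "\<And>t. t \<in> {a..<s} \<Longrightarrow> F t = L t"
    and t: "t \<in> {a..b} - {s}"
  shows "(F' has_integral (F t - F a - (if s < t then R s - L s else 0))) {a..t}"
proof -
  have derL: "(L has_vector_derivative F' x) (at x)" if "x \<in> {a<..<s}" for x
  proof -
    have "(F has_vector_derivative F' x) (at x)"
      using der[of x] that s by (simp add: at_within_Icc_at)
    then show ?thesis
      by (rule has_vector_derivative_transform_within_open[of _ _ _ "{a<..<s}"])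
        (use L(2) that s in auto)
  qed
  have derR: "(R has_vector_derivative F' x) (at x)" if "x \<in> {s<..<b}" for x
  proof -
    have "(F has_vector_derivative F' x) (at x)"
      using der[of x] that s by (simp add: at_within_Icc_at)
    then show ?thesis
      by (rule has_vector_derivative_transform_within_open[of _ _ _ "{s<..<b}"])
        (use R(2) that s in auto)
  qed
  show ?thesis
  proof (cases "s < t")
    case False
    then have "t < s" using t by auto
    have "(F' has_integral (L t - L a)) {a..t}"
      using t \<open>t < s\<close> by (intro fundamental_theorem_of_calculus_interior derL continuous_on_subset[OF L(1)]) auto
    then show ?thesis using False L(2)[of t] L(2)[of a] t \<open>t < s\<close> s by simp
  next
    case True
    have "(F' has_integral (L s - L a)) {a..s}"
      using s by (intro fundamental_theorem_of_calculus_interior derL L(1)) auto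
    moreover have "(F' has_integral (R t - R s)) {s..t}"
      using t True by (intro fundamental_theorem_of_calculus_interior derR continuous_on_subset[OF R(1)]) auto
    ultimately have "(F' has_integral (L s - L a + (R t - R s))) {a..t}"
      using s True by (intro has_integral_combine[of a s t]) auto
    moreover have "L s - L a + (R t - R s) = F t - F a - (R s - L s)"
      using True t s R(2)[of t] L(2)[of a] by simp
    ultimately show ?thesis using True by simp
  qed
qed

lemma continuous_on_bounded_cutoff:
  fixes \<sigma> :: "real \<Rightarrow> real"
  assumes "continuous_on {a..b} \<sigma>"
  shows "(\<lambda>s. indicator {a..b} s * \<sigma> s) \<in> borel_measurable borel"
    and "\<exists>D. \<forall>s. \<bar>indicator {a..b} s * \<sigma> s\<bar> \<le> D"
    and "integrable lborel (\<lambda>s. indicator {a..b} s * \<sigma> s)"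
  using borel_measurable_bounded_piecewise[of "{a..b}" "{}" \<sigma> "\<lambda>_. 0" "\<lambda>s. indicator {a..b} s * \<sigma> s"]
    borel_integrable_atLeastAtMost'[OF assms] assms
  by (simp_all add: set_integrable_def)

text \<open>The branches \<open>k\<close>, \<open>k'\<close> play the role of the derivatives of
  \<open>h\<close>, \<open>h'\<close>, and \<open>c\<close> is the jump across the diagonal.
  Integrating \<open>int\<close> against \<sigma> and exchanging the integrals gives \<open>V t = V
  a + integral {a..t} (\<lambda>x. W x + c * \<sigma> x)\<close>. The integrand is continuous, so
  the fundamental theorem yields the derivative.\<close>

lemma tri_kernel_Leibniz:
  assumes ab: "a < b" and \<sigma>: "continuous_on {a..b} \<sigma>"
    and h: "continuous_on (lower_tri a b) h" "continuous_on (upper_tri a b) h'"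
    and k: "continuous_on (lower_tri a b) k" "continuous_on (upper_tri a b) k'"
    and int: "\<And>t s. t \<in> {a..b} \<Longrightarrow> s \<in> {a<..<b} \<Longrightarrow> t \<noteq> s \<Longrightarrow>
      ((\<lambda>x. tri_kernel a b k k' x s) has_integral
        (tri_kernel a b h h' t s - tri_kernel a b h h' a s - (if s < t then c else 0))) {a..t}"
    and t: "t \<in> {a..b}"
  shows "((\<lambda>t. LBINT s. tri_kernel a b h h' t s * (indicator {a..b} s * \<sigma> s)) has_vector_derivative
    (LBINT s. tri_kernel a b k k' t s * (indicator {a..b} s * \<sigma> s)) + c * \<sigma> t) (at t within {a..b})"
proof -
  define S where "S = (\<lambda>s. indicator {a..b} s * \<sigma> s)"
  define V where "V = (\<lambda>t. LBINT s. tri_kernel a b h h' t s * S s)"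
  define W where "W t = (LBINT s. tri_kernel a b k k' t s * S s)" for t
  have S: "S \<in> borel_measurable borel" "integrable lborel S" "\<And>s. s \<notin> {a..b} \<Longrightarrow> S s = 0"
    using continuous_on_bounded_cutoff[OF \<sigma>] by (auto simp: S_def)
  obtain D where D: "\<And>s. \<bar>S s\<bar> \<le> D"
    using continuous_on_bounded_cutoff(2)[OF \<sigma>] unfolding S_def by blast
  have W: "continuous_on {a..b} W"
    unfolding W_def by (rule tri_kernel_integral_continuous_on[OF k S(2,3)])
  have V: "V t = V a + integral {a..t} (\<lambda>x. W x + c * \<sigma> x)" if t: "t \<in> {a..b}" for t
  proof -
    note F = bounded_kernel_Fubini[OF lborel.sigma_finite_measure_axioms _ _
        bounded_kernel_tri_kernel[OF k] S(1) D, of "{a..t}"]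
    let ?I = "\<lambda>s. (LBINT x. indicator {a..t} x * tri_kernel a b k k' x s) * S s"
    have \<sigma>t: "continuous_on {a..t} \<sigma>" and Wt: "continuous_on {a..t} W"
      using t by (auto intro: continuous_on_subset[OF \<sigma>] continuous_on_subset[OF W])
    have I: "integrable lborel ?I" by (rule F) (use ab in auto)
    have J: "integrable lborel (\<lambda>s. c * (indicator {a..t} s * \<sigma> s))"
      using continuous_on_bounded_cutoff(3)[OF \<sigma>t] by simp
    note slice = bounded_kernel_slice_integrable[OF bounded_kernel_tri_kernel[OF h] S(2)]
    have "V t - V a = (LBINT s. tri_kernel a b h h' t s * S s - tri_kernel a b h h' a s * S s)"
      unfolding V_def using slice by simp
    also have "\<dots> = (LBINT s. ?I s + c * (indicator {a..t} s * \<sigma> s))"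
    proof (rule integral_cong_AE)
      show "AE s in lborel. tri_kernel a b h h' t s * S s - tri_kernel a b h h' a s * S s =
          ?I s + c * (indicator {a..t} s * \<sigma> s)"
        \<comment> \<open>The hypothesis \<open>int\<close> covers interior \<open>s\<close>
          different from \<open>t\<close>. At \<open>s = t\<close> the indicator of
          \<open>{a..t}\<close> also differs from the condition \<open>s < t\<close>.\<close>
        using AE_lborel_singleton[of a] AE_lborel_singleton[of b] AE_lborel_singleton[of t]
      proof eventually_elim
        case (elim s)
        show ?case
        proof (cases "s \<in> {a..b}")
          case True
          have "set_integrable lborel {a..t} (\<lambda>x. tri_kernel a b k k' x s)"
          proof -
            obtain B where "\<And>t s. \<bar>tri_kernel a b k k' t s\<bar> \<le> B"
              using bounded_kernel_tri_kernel[OF k] unfolding bounded_kernel_def by blast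
            then show ?thesis
              using bounded_kernel_sections(2)[OF bounded_kernel_tri_kernel[OF k]]
              unfolding set_integrable_def
              using t by (intro integrableI_bounded_set_indicator[where B = B]) auto
          qed
          then have "(LBINT x. indicator {a..t} x * tri_kernel a b k k' x s) =
              integral {a..t} (\<lambda>x. tri_kernel a b k k' x s)"
            using set_borel_integral_eq_integral(2)[of "{a..t}" "\<lambda>x. tri_kernel a b k k' x s"]
            by (simp add: set_lebesgue_integral_def)
          also have "\<dots> = tri_kernel a b h h' t s - tri_kernel a b h h' a s - (if s < t then c else 0)"
            using int[of t s] t elim True by (intro integral_unique) auto
          finally have eq: "tri_kernel a b h h' t s - tri_kernel a b h h' a s =
              (LBINT x. indicator {a..t} x * tri_kernel a b k k' x s) + (if s < t then c else 0)"
            by linarith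
          have "(if s < t then c else 0) * S s = c * (indicator {a..t} s * \<sigma> s)"
            using elim t True by (auto simp: S_def indicator_def)
          then show ?thesis
            unfolding left_diff_distrib[symmetric] eq by (simp only: distrib_right)
        qed (use t in \<open>auto simp: S(3)\<close>)
      qed
      show "(\<lambda>s. tri_kernel a b h h' t s * S s - tri_kernel a b h h' a s * S s) \<in> borel_measurable lborel"
        by (rule borel_measurable_integrable[OF Bochner_Integration.integrable_diff[OF slice slice]])
      show "(\<lambda>s. ?I s + c * (indicator {a..t} s * \<sigma> s)) \<in> borel_measurable lborel"
        by (rule borel_measurable_integrable[OF Bochner_Integration.integrable_add[OF I J]])
    qed
    also have "\<dots> = (LBINT s. ?I s) + (LBINT s. c * (indicator {a..t} s * \<sigma> s))"
      using I J by (rule Bochner_Integration.integral_add)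
    also have "(LBINT s. ?I s) = (LBINT x. indicator {a..t} x * W x)"
      unfolding W_def by (rule F) (use ab in auto)
    also have "\<dots> = integral {a..t} W"
      using set_borel_integral_eq_integral(2)[OF borel_integrable_atLeastAtMost'[OF Wt]]
      by (simp add: set_lebesgue_integral_def)
    also have "(LBINT s. c * (indicator {a..t} s * \<sigma> s)) = integral {a..t} (\<lambda>x. c * \<sigma> x)"
      using set_borel_integral_eq_integral(2)[OF borel_integrable_atLeastAtMost'[OF \<sigma>t]]
      by (simp add: set_lebesgue_integral_def)
    also have "integral {a..t} W + integral {a..t} (\<lambda>x. c * \<sigma> x) =
        integral {a..t} (\<lambda>x. W x + c * \<sigma> x)"
      by (rule Henstock_Kurzweil_Integration.integral_add[symmetric])
        (intro integrable_continuous_real continuous_on_mult_left Wt \<sigma>t)+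
    finally show ?thesis by linarith
  qed
  have "((\<lambda>t. V a + integral {a..t} (\<lambda>x. W x + c * \<sigma> x)) has_vector_derivative
      W t + c * \<sigma> t) (at t within {a..b})"
    using has_vector_derivative_add[OF has_vector_derivative_const
        integral_has_vector_derivative[OF continuous_on_add[OF W continuous_on_mult_left[OF \<sigma>]] t]]
    by simp
  from has_vector_derivative_transform[OF t _ this, of V]
  have "(V has_vector_derivative W t + c * \<sigma> t) (at t within {a..b})"
    using V by blast
  then show ?thesis unfolding V_def W_def S_def .
qed

lemma tendsto_at_right_eq_continuous_on:
  fixes F R :: "real \<Rightarrow> real"
  assumes "s < b" "continuous_on {s..b} R" "\<And>t. t \<in> {s<..b} \<Longrightarrow> F t = R t"
  shows "(F \<longlongrightarrow> R s) (at_right s)"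
proof -
  have "(R \<longlongrightarrow> R s) (at s within {s..b})"
    using assms(1,2) by (simp add: continuous_on_def)
  then have "(R \<longlongrightarrow> R s) (at_right s)"
    using assms(1) by (simp add: at_within_Icc_at_right)
  moreover have "\<forall>\<^sub>F t in at_right s. R t = F t"
    using eventually_at_right_less[of s] eventually_at_right_real[OF assms(1)]
    by eventually_elim (use assms(3) in auto)
  ultimately show ?thesis by (rule Lim_transform_eventually)
qed

lemma tendsto_at_left_eq_continuous_on:
  fixes F L :: "real \<Rightarrow> real"
  assumes "a < s" "continuous_on {a..s} L" "\<And>t. t \<in> {a..<s} \<Longrightarrow> F t = L t"
  shows "(F \<longlongrightarrow> L s) (at_left s)"
proof -
  have "(L \<longlongrightarrow> L s) (at s within {a..s})"
    using assms(1,2) by (simp add: continuous_on_def)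
  then have "(L \<longlongrightarrow> L s) (at_left s)"
    using assms(1) by (simp add: at_within_Icc_at_left)
  moreover have "\<forall>\<^sub>F t in at_left s. L t = F t"
    using eventually_at_left_real[OF assms(1)]
    by eventually_elim (use assms(3) in auto)
  ultimately show ?thesis by (rule Lim_transform_eventually)
qed

subsection \<open>The Green's function\<close>

lemma is_greenD:
  assumes "is_green n a b p M \<alpha> \<beta> g"
  shows "n \<ge> 2 \<longrightarrow>
        (\<forall>s\<in>{a..b}. Cn_on (n - 2) {a..b} (\<lambda>t. g t s)) \<and>
        (\<forall>k\<le>n - 2. continuous_on ({a..b} \<times> {a..b})
           (\<lambda>(t, s). nderiv {a..b} k (\<lambda>x. g x s) t))"
    and "n = 1 \<longrightarrow>
        continuous_on (lower_tri a b) (\<lambda>(t, s). g t s) \<or>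
        continuous_on (upper_tri a b) (\<lambda>(t, s). g t s)"
    and "\<forall>k<n. \<forall>s\<in>{a..b}. \<forall>t\<in>{a..b} - {s}.
        nderiv {a..b} k (\<lambda>x. g x s) differentiable (at t within {a..b})"
    and "\<forall>k\<le>n. \<forall>\<Delta>\<in>{lower_tri a b, upper_tri a b}. \<exists>h.
        continuous_on \<Delta> h \<and>
        (\<forall>(t, s)\<in>\<Delta>. t \<noteq> s \<longrightarrow> nderiv {a..b} k (\<lambda>x. g x s) t = h (t, s))"
    and "\<forall>s\<in>{a..b}. \<forall>t\<in>{a..b} - {s}. diff_op n a b p M (\<lambda>x. g x s) t = 0"
    and "\<forall>s\<in>{a<..<b}. \<exists>l r.
        (nderiv {a..b} (n - 1) (\<lambda>x. g x s) \<longlongrightarrow> r) (at_right s) \<and>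
        (nderiv {a..b} (n - 1) (\<lambda>x. g x s) \<longlongrightarrow> l) (at_left s) \<and>
        r - l = 1"
    and "\<forall>s\<in>{a<..<b}. \<forall>i. bdry_op n a b \<alpha> \<beta> i (\<lambda>x. g x s) = 0"
  using assms[unfolded is_green_def] by - (elim conjE, assumption)+

text \<open>The extensions to the closed triangles are given for each order \<open>k\<close>
  separately; a finite choice collects them into two families.\<close>

lemma green_kernels:
  assumes "is_green n a b p M \<alpha> \<beta> g"
  obtains h h' where
    "\<And>k. k \<le> n \<Longrightarrow> continuous_on (lower_tri a b) (h k)"
    "\<And>k. k \<le> n \<Longrightarrow> continuous_on (upper_tri a b) (h' k)"
    "\<And>k t s. k \<le> n \<Longrightarrow> a \<le> s \<Longrightarrow> s < t \<Longrightarrow> t \<le> b \<Longrightarrow>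
      nderiv {a..b} k (\<lambda>x. g x s) t = h k (t, s)"
    "\<And>k t s. k \<le> n \<Longrightarrow> a \<le> t \<Longrightarrow> t < s \<Longrightarrow> s \<le> b \<Longrightarrow>
      nderiv {a..b} k (\<lambda>x. g x s) t = h' k (t, s)"
proof -
  define Q where "Q \<Delta> k f \<longleftrightarrow> continuous_on \<Delta> f \<and>
      (\<forall>(t, s)\<in>\<Delta>. t \<noteq> s \<longrightarrow> nderiv {a..b} k (\<lambda>x. g x s) t = f (t, s))" for \<Delta> k f
  have ex: "\<forall>k\<in>{..n}. \<exists>f. Q \<Delta> k f" if "\<Delta> \<in> {lower_tri a b, upper_tri a b}" for \<Delta>
  proof
    fix k assume "k \<in> {..n}"
    then have "k \<le> n" by simp
    show "\<exists>f. Q \<Delta> k f"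
      unfolding Q_def
      by (rule is_greenD(4)[OF assms, THEN spec, THEN mp, THEN bspec, OF \<open>k \<le> n\<close> that])
  qed
  obtain h where h: "\<forall>k\<in>{..n}. Q (lower_tri a b) k (h k)"
    using bchoice[OF ex[of "lower_tri a b"]] by auto
  obtain h' where h': "\<forall>k\<in>{..n}. Q (upper_tri a b) k (h' k)"
    using bchoice[OF ex[of "upper_tri a b"]] by auto
  show ?thesis
  proof (rule that[of h h'])
    fix k t s assume "k \<le> n" "a \<le> s" "s < t" "t \<le> b"
    then show "nderiv {a..b} k (\<lambda>x. g x s) t = h k (t, s)"
      using bspec[OF h, of k] by (auto simp: Q_def lower_tri_def)
  next
    fix k t s assume "k \<le> n" "a \<le> t" "t < s" "s \<le> b"
    then show "nderiv {a..b} k (\<lambda>x. g x s) t = h' k (t, s)"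
      using bspec[OF h', of k] by (auto simp: Q_def upper_tri_def)
  next
    fix k assume "k \<le> n"
    then show "continuous_on (lower_tri a b) (h k)" "continuous_on (upper_tri a b) (h' k)"
      using bspec[OF h, of k] bspec[OF h', of k] by (auto simp: Q_def)
  qed
qed

text \<open>One-sided limits are unique, so the values of the extensions at \<open>s\<close> are the
  limits of the derivative. For \<open>k = n - 1\<close> their difference is the prescribed 1; for
  lower orders continuity on the square makes the two limits equal.\<close>

lemma green_jump:
  assumes green: "is_green n a b p M \<alpha> \<beta> g" and k: "k < n" and s: "s \<in> {a<..<b}"
    and R: "continuous_on {s..b} R" "\<And>t. t \<in> {s<..b} \<Longrightarrow> nderiv {a..b} k (\<lambda>x. g x s) t = R t"
    and L: "continuous_on {a..s} L" "\<And>t. t \<in> {a..<s} \<Longrightarrow> nderiv {a..b} k (\<lambda>x. g x s) t = L t"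
  shows "R s - L s = (if k = n - 1 then 1 else 0)"
proof -
  let ?F = "nderiv {a..b} k (\<lambda>x. g x s)"
  have limR: "(?F \<longlongrightarrow> R s) (at_right s)"
    using s by (intro tendsto_at_right_eq_continuous_on[OF _ R]) auto
  have limL: "(?F \<longlongrightarrow> L s) (at_left s)"
    using s by (intro tendsto_at_left_eq_continuous_on[OF _ L]) auto
  show ?thesis
  proof (cases "k = n - 1")
    case True
    then obtain l r where "(?F \<longlongrightarrow> r) (at_right s)" "(?F \<longlongrightarrow> l) (at_left s)" "r - l = 1"
      using is_greenD(6)[OF green] s by blast
    moreover have "r = R s" using tendsto_unique[OF _ calculation(1) limR] by simp
    moreover have "l = L s" using tendsto_unique[OF _ calculation(2) limL] by simp
    ultimately show ?thesis using True by simp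
  next
    case False
    then have k2: "n \<ge> 2" "k \<le> n - 2" using k by auto
    have "continuous_on ({a..b} \<times> {a..b}) (\<lambda>(t, s). nderiv {a..b} k (\<lambda>x. g x s) t)"
      by (rule is_greenD(1)[OF green, THEN mp, OF k2(1), THEN conjunct2, rule_format, OF k2(2)])
    then have "continuous_on {a..b} (\<lambda>t. (\<lambda>(t, s). nderiv {a..b} k (\<lambda>x. g x s) t) (t, s))"
      using s by (elim continuous_on_compose2) (auto intro!: continuous_intros)
    then have F: "continuous_on {a..b} ?F" by simp
    have "(?F \<longlongrightarrow> ?F s) (at_right s)"
      using s by (intro tendsto_at_right_eq_continuous_on[of s b] continuous_on_subset[OF F]) auto
    then have "R s = ?F s" using tendsto_unique[OF _ limR] by simp
    moreover have "(?F \<longlongrightarrow> ?F s) (at_left s)"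
      using s by (intro tendsto_at_left_eq_continuous_on[of a s] continuous_on_subset[OF F]) auto
    then have "L s = ?F s" using tendsto_unique[OF _ limL] by simp
    ultimately show ?thesis using False by simp
  qed
qed

text \<open>The kernel here is \<open>g\<close> itself, diagonal included: it will be integrated
  against measures that may have an atom at \<open>s\<close>, so its values at \<open>t = s\<close>
  cannot be altered. They are controlled because \<open>g\<close> is continuous on at least one
  closed triangle, by the clause for \<open>n = 1\<close> or by continuity on the square.\<close>

lemma green_bounded_kernel:
  assumes green: "is_green n a b p M \<alpha> \<beta> g" and n: "n > 0"
  shows "bounded_kernel a b (\<lambda>t s. indicator ({a..b} \<times> {a..b}) (t, s) * g t s)"
proof -
  let ?K = "\<lambda>t s. indicator ({a..b} \<times> {a..b}) (t, s) * g t s"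
  obtain h h' where h: "continuous_on (lower_tri a b) (h (0::nat))"
    and h': "continuous_on (upper_tri a b) (h' (0::nat))"
    and D: "\<And>t s. a \<le> s \<Longrightarrow> s < t \<Longrightarrow> t \<le> b \<Longrightarrow> g t s = h 0 (t, s)"
    and D': "\<And>t s. a \<le> t \<Longrightarrow> t < s \<Longrightarrow> s \<le> b \<Longrightarrow> g t s = h' 0 (t, s)"
    by (rule green_kernels[OF green]) (metis nderiv.simps(1) zero_le)
  have sub: "lower_tri a b \<union> upper_tri a b \<subseteq> {a..b} \<times> {a..b}"
    "upper_tri a b \<union> lower_tri a b \<subseteq> {a..b} \<times> {a..b}"
    by (auto simp: lower_tri_def upper_tri_def)
  have "continuous_on (lower_tri a b) (case_prod g) \<or> continuous_on (upper_tri a b) (case_prod g)"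
  proof (cases "n = 1")
    case True
    then show ?thesis using is_greenD(2)[OF green] by simp
  next
    case False
    then have n2: "n \<ge> 2" using n by simp
    have "continuous_on ({a..b} \<times> {a..b}) (\<lambda>(t, s). nderiv {a..b} 0 (\<lambda>x. g x s) t)"
      by (rule is_greenD(1)[OF green, THEN mp, OF n2, THEN conjunct2, rule_format, OF le0])
    then have "continuous_on ({a..b} \<times> {a..b}) (case_prod g)" by simp
    then show ?thesis using sub by (blast intro: continuous_on_subset)
  qed
  \<comment> \<open>The triangle on which \<open>g\<close> itself is continuous is put first and so
    owns the diagonal; on the other one the extension is used off the diagonal only.\<close>
  then show ?thesis
  proof
    assume "continuous_on (lower_tri a b) (case_prod g)"
    from compact_lower_tri compact_upper_tri sub(1) this h' show ?thesis
      by (rule bounded_kernel_piecewise) (use D' in \<open>auto simp: lower_tri_def upper_tri_def\<close>)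
  next
    assume "continuous_on (upper_tri a b) (case_prod g)"
    from compact_upper_tri compact_lower_tri sub(2) this h show ?thesis
      by (rule bounded_kernel_piecewise) (use D in \<open>auto simp: lower_tri_def upper_tri_def\<close>)
  qed
qed

lemma green_solves:
  assumes ab: "a < b" and n: "n > 0" and green: "is_green n a b p M \<alpha> \<beta> g"
    and \<sigma>: "continuous_on {a..b} \<sigma>"
  shows "solves n a b p M \<alpha> \<beta> \<sigma> (\<lambda>_. 0) (\<lambda>t. LBINT s:{a..b}. g t s * \<sigma> s)"
proof -
  let ?u = "\<lambda>t. LBINT s:{a..b}. g t s * \<sigma> s"
  let ?D = "\<lambda>k s. nderiv {a..b} k (\<lambda>x. g x s)"
  obtain h h' where h: "\<And>k. k \<le> n \<Longrightarrow> continuous_on (lower_tri a b) (h k)"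
    and h': "\<And>k. k \<le> n \<Longrightarrow> continuous_on (upper_tri a b) (h' k)"
    and D: "\<And>k t s. k \<le> n \<Longrightarrow> a \<le> s \<Longrightarrow> s < t \<Longrightarrow> t \<le> b \<Longrightarrow> ?D k s t = h k (t, s)"
    and D': "\<And>k t s. k \<le> n \<Longrightarrow> a \<le> t \<Longrightarrow> t < s \<Longrightarrow> s \<le> b \<Longrightarrow> ?D k s t = h' k (t, s)"
    using green_kernels[OF green] by blast
  \<comment> \<open>\<open>G k\<close> agrees with the derivative of order \<open>k\<close> off the
    diagonal and has controlled values on it.\<close>
  define G where "G k = tri_kernel a b (h k) (h' k)" for k
  define S where "S = (\<lambda>s. indicator {a..b} s * \<sigma> s)"
  have S: "integrable lborel S" "\<And>s. s \<notin> {a..b} \<Longrightarrow> S s = 0"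
    using continuous_on_bounded_cutoff(3)[OF \<sigma>] by (auto simp: S_def)
  have G: "G k t s = ?D k s t" if "k \<le> n" "t \<in> {a..b}" "s \<in> {a..b}" "t \<noteq> s" for k t s
    using that D[of k s t] D'[of k t s]
    by (cases "s < t") (auto simp: G_def tri_kernel_def lower_tri_def upper_tri_def)
  have G_int: "integrable lborel (\<lambda>s. G k t s * S s)" if "k \<le> n" for k t
    unfolding G_def using bounded_kernel_slice_integrable[OF bounded_kernel_tri_kernel[OF h h'] S(1)] that by blast
  have rel: "((\<lambda>x. G (Suc k) x s) has_integral
      (G k t s - G k a s - (if s < t then if Suc k = n then 1 else 0 else 0))) {a..t}"
    if k: "k < n" and t: "t \<in> {a..b}" and s: "s \<in> {a<..<b}" and ts: "t \<noteq> s" for k t s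
  proof -
    have R: "continuous_on {s..b} (\<lambda>t. h k (t, s))"
      using s k by (intro continuous_on_compose2[OF h[of k]] continuous_intros)
        (auto simp: lower_tri_def)
    have L: "continuous_on {a..s} (\<lambda>t. h' k (t, s))"
      using s k by (intro continuous_on_compose2[OF h'[of k]] continuous_intros)
        (auto simp: upper_tri_def)
    have der: "(?D k s has_vector_derivative ?D (Suc k) s t) (at t within {a..b})"
      if "t \<in> {a..b} - {s}" for t
    proof -
      have "?D k s differentiable (at t within {a..b})"
        using is_greenD(3)[OF green] that k s by auto
      then show ?thesis by (simp add: vector_derivative_works)
    qed
    have "(?D (Suc k) s has_integral
        (?D k s t - ?D k s a - (if s < t then h k (s, s) - h' k (s, s) else 0))) {a..t}"
      using has_integral_derivative_jump[OF s der R _ L] k s t ts D[of k s] D'[of k _ s] by simp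
    also have "h k (s, s) - h' k (s, s) = (if Suc k = n then 1 else 0)"
      using green_jump[OF green k s R _ L] k s D[of k s] D'[of k _ s] by (cases "Suc k = n") auto
    \<comment> \<open>The derivative of \<open>g\<close> and the kernel may differ at
      \<open>x = s\<close>, a single point that does not affect the integral.\<close>
    finally have "((\<lambda>x. G (Suc k) x s) has_integral
        (?D k s t - ?D k s a - (if s < t then if Suc k = n then 1 else 0 else 0))) {a..t}"
      using k s t by (elim has_integral_spike_finite[of "{s}", rotated 2]) (auto simp: G)
    then show ?thesis using G[of k t s] G[of k a s] k s t ts by simp
  qed
  \<comment> \<open>The chain of derivatives of the integral. The extra \<sigma> at
    \<open>k = n\<close> stems from the unit jump of the derivative of order \<open>n - 1\<close>,
    the only order below \<open>n\<close> that jumps.\<close>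
  define W where "W = (\<lambda>k t. (LBINT s. G k t s * S s) + (if k = n then \<sigma> t else 0))"
  have W_der: "(W k has_vector_derivative W (Suc k) t) (at t within {a..b})"
    if k: "k < n" and t: "t \<in> {a..b}" for k t
  proof -
    have "((\<lambda>t. LBINT s. G k t s * S s) has_vector_derivative
        (LBINT s. G (Suc k) t s * S s) + (if Suc k = n then 1 else 0) * \<sigma> t) (at t within {a..b})"
      unfolding G_def S_def using k
      by (intro tri_kernel_Leibniz[OF ab \<sigma> _ _ _ _ _ t] h h' rel[unfolded G_def]) auto
    then show ?thesis using k by (cases "Suc k = n") (auto simp: W_def)
  qed
  have W_cont: "continuous_on {a..b} (W n)"
    unfolding W_def G_def using \<sigma> tri_kernel_integral_continuous_on[OF h h' S]
    by (auto intro!: continuous_intros)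
  have u: "?u t = W 0 t" if t: "t \<in> {a..b}" for t
  proof -
    let ?K = "\<lambda>t s. indicator ({a..b} \<times> {a..b}) (t, s) * g t s"
    have "?u t = (LBINT s. ?K t s * S s)"
      unfolding set_lebesgue_integral_def using t
      by (intro Bochner_Integration.integral_cong) (auto simp: S_def indicator_def)
    \<comment> \<open>\<open>g\<close> and \<open>G 0\<close> can differ on the diagonal, that is,
      at \<open>s = t\<close> only.\<close>
    also have "\<dots> = (LBINT s. G 0 t s * S s)"
    proof (rule integral_cong_AE)
      show "AE s in lborel. ?K t s * S s = G 0 t s * S s"
        using AE_lborel_singleton[of t]
      proof eventually_elim
        case (elim s)
        then show ?case
          using G[of 0 t s] t by (cases "s \<in> {a..b}") (auto simp: S(2))
      qed
    qed (intro borel_measurable_integrable G_int le0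
        bounded_kernel_slice_integrable[OF green_bounded_kernel[OF green n] S(1)])+
    finally show ?thesis using n by (simp add: W_def)
  qed
  have eq: "nderiv {a..b} k ?u t = W k t" if "k \<le> n" "t \<in> {a..b}" for k t
    using nderiv_eqI[of a b n W ?u] ab W_der u that by blast
  have "Cn_on n {a..b} ?u"
    using Cn_onI[of a b n W ?u] ab W_der W_cont u by blast
  moreover have "diff_op n a b p M ?u t = \<sigma> t" if t: "t \<in> {a..b}" for t
  proof -
    have "diff_op n a b p M ?u t = \<sigma> t + (LBINT s. G n t s * S s) +
        (\<Sum>i=1..n. p i t * (LBINT s. G (n - i) t s * S s)) + M * (LBINT s. G 0 t s * S s)"
    proof -
      have "(\<Sum>i=1..n. p i t * W (n - i) t) = (\<Sum>i=1..n. p i t * (LBINT s. G (n - i) t s * S s))"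
        by (rule sum.cong) (auto simp: W_def)
      moreover have "W n t = (LBINT s. G n t s * S s) + \<sigma> t" "W 0 t = (LBINT s. G 0 t s * S s)"
        using n by (simp_all add: W_def)
      ultimately show ?thesis
        unfolding diff_op_def using t u[OF t] by (simp add: eq)
    qed
    also have "\<dots> = \<sigma> t + (LBINT s. G n t s * S s + (\<Sum>i=1..n. p i t * (G (n - i) t s * S s)) +
        M * (G 0 t s * S s))"
      by (simp add: G_int)
    \<comment> \<open>For every \<open>s\<close> in the interval other than \<open>t\<close> the
      integrand is \<open>S s\<close> times the operator applied to \<open>g(\<cdot>, s)\<close>,
      which vanishes at \<open>t\<close>.\<close>
    also have "(LBINT s. G n t s * S s + (\<Sum>i=1..n. p i t * (G (n - i) t s * S s)) +
        M * (G 0 t s * S s)) = 0"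
    proof (rule integral_eq_zero_AE)
      show "AE s in lborel. G n t s * S s + (\<Sum>i=1..n. p i t * (G (n - i) t s * S s)) +
          M * (G 0 t s * S s) = 0"
        using AE_lborel_singleton[of t]
      proof eventually_elim
        case (elim s)
        show ?case
        proof (cases "s \<in> {a..b}")
          case True
          then have "diff_op n a b p M (\<lambda>x. g x s) t = 0"
            using is_greenD(5)[OF green] elim t by blast
          then have "G n t s + (\<Sum>i=1..n. p i t * G (n - i) t s) + M * G 0 t s = 0"
            using True t elim by (simp add: diff_op_def G)
          then have "(G n t s + (\<Sum>i=1..n. p i t * G (n - i) t s) + M * G 0 t s) * S s = 0" by simp
          then show ?thesis by (simp add: algebra_simps sum_distrib_left)
        qed (simp add: S(2))
      qed
    qed
    finally show ?thesis by simp
  qed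
  moreover have "bdry_op n a b \<alpha> \<beta> i ?u = 0" for i
  proof -
    have "bdry_op n a b \<alpha> \<beta> i ?u =
        (\<Sum>j<n. \<alpha> i j * (LBINT s. G j a s * S s) + \<beta> i j * (LBINT s. G j b s * S s))"
      unfolding bdry_op_def using ab by (intro sum.cong) (auto simp: eq W_def)
    also have "\<dots> = (LBINT s. (\<Sum>j<n. \<alpha> i j * (G j a s * S s) + \<beta> i j * (G j b s * S s)))"
      by (simp add: G_int less_imp_le)
    also have "\<dots> = 0"
    proof (rule integral_eq_zero_AE)
      show "AE s in lborel. (\<Sum>j<n. \<alpha> i j * (G j a s * S s) + \<beta> i j * (G j b s * S s)) = 0"
        \<comment> \<open>The boundary conditions hold for interior \<open>s\<close>, and there
          \<open>G j\<close> equals the derivative of \<open>g\<close> at both end points.\<close>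
        using AE_lborel_singleton[of a] AE_lborel_singleton[of b]
      proof eventually_elim
        case (elim s)
        show ?case
        proof (cases "s \<in> {a..b}")
          case True
          then have "bdry_op n a b \<alpha> \<beta> i (\<lambda>x. g x s) = 0"
            using is_greenD(7)[OF green] elim by simp
          then have "(\<Sum>j<n. \<alpha> i j * G j a s + \<beta> i j * G j b s) = 0"
            using True ab elim by (simp add: bdry_op_def G)
          then have "(\<Sum>j<n. \<alpha> i j * G j a s + \<beta> i j * G j b s) * S s = 0" by simp
          then show ?thesis by (simp add: algebra_simps sum_distrib_left)
        qed (simp add: S(2))
      qed
    qed
    finally show ?thesis .
  qed
  ultimately show ?thesis unfolding solves_def by blast
qed

subsection \<open>Functionals of the Green's function\<close>

text \<open>The exchange of a functional with the integral against \<sigma>, for one of the two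
  measures whose difference represents the functional.\<close>

lemma bounded_kernel_measure_Fubini:
  assumes mu: "finite_measure \<mu>" "sets \<mu> = sets (restrict_space borel {a..b})"
    and K: "bounded_kernel a b (\<lambda>t s. indicator ({a..b} \<times> {a..b}) (t, s) * g t s)"
    and \<sigma>: "continuous_on {a..b} \<sigma>"
  shows "set_integrable lborel {a..b} (\<lambda>s. (\<integral>x. g x s \<partial>\<mu>) * \<sigma> s)"
    and "(LBINT s:{a..b}. (\<integral>x. g x s \<partial>\<mu>) * \<sigma> s) = (\<integral>x. (LBINT s:{a..b}. g x s * \<sigma> s) \<partial>\<mu>)"
proof -
  let ?K = "\<lambda>t s. indicator ({a..b} \<times> {a..b}) (t, s) * g t s"
  define S where "S = (\<lambda>s. indicator {a..b} s * \<sigma> s)"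
  have S: "S \<in> borel_measurable borel"
    using continuous_on_bounded_cutoff(1)[OF \<sigma>] by (simp add: S_def)
  obtain D where D: "\<And>s. \<bar>S s\<bar> \<le> D"
    using continuous_on_bounded_cutoff(2)[OF \<sigma>] unfolding S_def by blast
  have space: "space \<mu> = {a..b}"
    using sets_eq_imp_space_eq[OF mu(2)] by (simp add: space_restrict_space)
  have id: "(\<lambda>x. x) \<in> measurable \<mu> borel"
    by (subst measurable_cong_sets[OF mu(2) refl]) (intro borel_measurable_continuous_on_restrict continuous_intros)
  \<comment> \<open>The measure \<mu> lives on the subspace \<open>{a..b}\<close>; pushed forward
    along the inclusion it becomes a finite Borel measure on the line, as the Fubini lemma
    requires.\<close>
  define N where "N = distr \<mu> borel (\<lambda>x. x)"
  interpret N: finite_measure N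
    unfolding N_def using mu(1) id by (rule finite_measure.finite_measure_distr)
  have finN: "emeasure N {a..b} < \<infinity>"
    by (simp add: N.emeasure_eq_measure)
  have setsN: "sets N = sets borel" by (simp add: N_def)
  note F = bounded_kernel_Fubini[OF N.sigma_finite_measure_axioms setsN finN K S D, of "{a..b}"]
  have "(\<integral>t. indicator {a..b} t * ?K t s \<partial>N) = (\<integral>x. g x s \<partial>\<mu>)" if "s \<in> {a..b}" for s
  proof -
    have "(\<integral>t. indicator {a..b} t * ?K t s \<partial>N) = (\<integral>t. indicator {a..b} t * ?K t s \<partial>\<mu>)"
      unfolding N_def
      by (intro integral_distr id borel_measurable_times bounded_kernel_sections(2)[OF K]) simp
    also have "\<dots> = (\<integral>x. g x s \<partial>\<mu>)"
      using that space by (intro Bochner_Integration.integral_cong) auto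
    finally show ?thesis .
  qed
  then have eq: "(\<integral>t. indicator {a..b} t * ?K t s \<partial>N) * S s =
      indicator {a..b} s *\<^sub>R ((\<integral>x. g x s \<partial>\<mu>) * \<sigma> s)" for s
    by (cases "s \<in> {a..b}") (auto simp: S_def)
  show "set_integrable lborel {a..b} (\<lambda>s. (\<integral>x. g x s \<partial>\<mu>) * \<sigma> s)"
    unfolding set_integrable_def eq[symmetric] by (rule F) simp
  have meas: "(\<lambda>t. LBINT s. ?K t s * S s) \<in> borel_measurable borel"
  proof (rule lborel.borel_measurable_lebesgue_integral)
    have [measurable]: "case_prod ?K \<in> borel_measurable (borel \<Otimes>\<^sub>M borel)"
      unfolding borel_prod using K by (simp add: bounded_kernel_def)
    have "(\<lambda>(t, s). ?K t s * S s) = (\<lambda>x. case_prod ?K x * S (snd x))"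
      by (auto simp: fun_eq_iff)
    also have "\<dots> \<in> borel_measurable (borel \<Otimes>\<^sub>M lborel)"
      using S by measurable
    finally show "(\<lambda>(t, s). ?K t s * S s) \<in> borel_measurable (borel \<Otimes>\<^sub>M lborel)" .
  qed
  have "(LBINT s:{a..b}. (\<integral>x. g x s \<partial>\<mu>) * \<sigma> s) =
      (\<integral>t. indicator {a..b} t * (LBINT s. ?K t s * S s) \<partial>N)"
    unfolding set_lebesgue_integral_def eq[symmetric] by (rule F) simp
  also have "\<dots> = (\<integral>t. indicator {a..b} t * (LBINT s. ?K t s * S s) \<partial>\<mu>)"
    unfolding N_def by (intro integral_distr id borel_measurable_times meas) simp
  also have "\<dots> = (\<integral>x. (LBINT s:{a..b}. g x s * \<sigma> s) \<partial>\<mu>)"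
  proof (rule Bochner_Integration.integral_cong[OF refl])
    fix t assume "t \<in> space \<mu>"
    then have t: "t \<in> {a..b}" using space by simp
    have "(LBINT s. ?K t s * S s) = (LBINT s:{a..b}. g t s * \<sigma> s)"
      unfolding set_lebesgue_integral_def using t
      by (intro Bochner_Integration.integral_cong) (auto simp: S_def indicator_def)
    then show "indicator {a..b} t * (LBINT s. ?K t s * S s) = (LBINT s:{a..b}. g t s * \<sigma> s)"
      using t by simp
  qed
  finally show "(LBINT s:{a..b}. (\<integral>x. g x s \<partial>\<mu>) * \<sigma> s) =
      (\<integral>x. (LBINT s:{a..b}. g x s * \<sigma> s) \<partial>\<mu>)" .
qed

text \<open>The integral of \<open>g\<close> against \<sigma> is continuous, so \<open>C\<close>
  acts on it through the representing pair, and Fubini applies to each of the two measures.\<close>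

lemma borel_ext_Fubini:
  assumes ab: "a < b" and C: "cont_lin_functional a b C"
    and K: "bounded_kernel a b (\<lambda>t s. indicator ({a..b} \<times> {a..b}) (t, s) * g t s)"
    and \<sigma>: "continuous_on {a..b} \<sigma>"
    and cont: "continuous_on {a..b} (\<lambda>t. LBINT s:{a..b}. g t s * \<sigma> s)"
  shows "set_integrable lborel {a..b} (\<lambda>s. borel_ext a b C (\<lambda>x. g x s) * \<sigma> s)"
    and "C (\<lambda>t. LBINT s:{a..b}. g t s * \<sigma> s) = (LBINT s:{a..b}. borel_ext a b C (\<lambda>x. g x s) * \<sigma> s)"
proof -
  obtain \<mu> \<nu> where some: "(SOME r. represents a b C r) = (\<mu>, \<nu>)" by fastforce
  have rep: "represents a b C (\<mu>, \<nu>)"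
    using someI_ex[OF represents_exists[OF ab C]] unfolding some .
  then have mu: "finite_measure \<mu>" "sets \<mu> = sets (restrict_space borel {a..b})"
    and nu: "finite_measure \<nu>" "sets \<nu> = sets (restrict_space borel {a..b})"
    and eq: "\<And>f. continuous_on {a..b} f \<Longrightarrow> C f = (\<integral>x. f x \<partial>\<mu>) - (\<integral>x. f x \<partial>\<nu>)"
    unfolding represents_def by auto
  \<comment> \<open>On continuous functions the chosen pair reproduces \<open>C\<close>, so both
    branches of \<open>borel_ext\<close> are the same formula and the jump for \<open>n = 1\<close>
    requires no separate case.\<close>
  have ext: "borel_ext a b C f = (\<integral>x. f x \<partial>\<mu>) - (\<integral>x. f x \<partial>\<nu>)" for f
    unfolding borel_ext_def some using eq by simp
  note F = bounded_kernel_measure_Fubini[OF mu K \<sigma>] bounded_kernel_measure_Fubini[OF nu K \<sigma>]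
  show "set_integrable lborel {a..b} (\<lambda>s. borel_ext a b C (\<lambda>x. g x s) * \<sigma> s)"
    unfolding ext left_diff_distrib by (intro set_integral_diff F)
  show "C (\<lambda>t. LBINT s:{a..b}. g t s * \<sigma> s) = (LBINT s:{a..b}. borel_ext a b C (\<lambda>x. g x s) * \<sigma> s)"
    unfolding eq[OF cont] ext left_diff_distrib set_integral_diff(2)[OF F(1,3)] F(2,4) ..
qed

section \<open>The nonlocal boundary value problem\<close>

lemma matrix_inv_mult:
  fixes A :: "real^'n^'n"
  assumes "det A \<noteq> 0"
  shows "A ** matrix_inv A = mat 1" "matrix_inv A ** A = mat 1"
proof -
  have "\<exists>A'. A ** A' = mat 1 \<and> A' ** A = mat 1"
    using assms by (simp add: invertible_det_nz[symmetric] invertible_def)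
  from someI_ex[OF this] show "A ** matrix_inv A = mat 1" "matrix_inv A ** A = mat 1"
    unfolding matrix_inv_def by auto
qed

theorem theorem2p6:
  fixes a b M :: real and n :: nat
    and p :: "nat \<Rightarrow> real \<Rightarrow> real"
    and \<alpha> \<beta> :: "'n::finite \<Rightarrow> nat \<Rightarrow> real"
    and C :: "'n \<Rightarrow> (real \<Rightarrow> real) \<Rightarrow> real"
    and g :: "real \<Rightarrow> real \<Rightarrow> real"
    and \<omega> :: "'n \<Rightarrow> real \<Rightarrow> real"
    and \<sigma> :: "real \<Rightarrow> real"
    and \<delta> :: "real ^ 'n"
  assumes "a < b" and "n = CARD('n)"
    and "\<And>i. i \<in> {1..n} \<Longrightarrow> continuous_on {a..b} (p i)"
    and "\<And>i. cont_lin_functional a b (C i)"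
    and "\<And>u. solves n a b p M \<alpha> \<beta> (\<lambda>_. 0) (\<lambda>_. 0) u \<Longrightarrow> \<forall>t\<in>{a..b}. u t = 0"
    and "is_green n a b p M \<alpha> \<beta> g"
    and "\<And>j. solves n a b p M \<alpha> \<beta> (\<lambda>_. 0) (\<lambda>k. if k = j then 1 else 0) (\<omega> j)"
    and "continuous_on {a..b} \<sigma>"
    and "det (mat 1 - coupling_matrix \<delta> C \<omega>) \<noteq> 0"
  shows "\<exists>u. solves n a b p M \<alpha> \<beta> \<sigma> (\<lambda>i. \<delta> $ i * C i u) u \<and>
    (\<forall>v. solves n a b p M \<alpha> \<beta> \<sigma> (\<lambda>i. \<delta> $ i * C i v) v \<longrightarrow> (\<forall>t\<in>{a..b}. v t = u t)) \<and>
    (\<forall>t\<in>{a..b}.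
       set_integrable lborel {a..b} (\<lambda>s. nonlocal_green a b g \<delta> C \<omega> t s * \<sigma> s) \<and>
       u t = (LBINT s:{a..b}. nonlocal_green a b g \<delta> C \<omega> t s * \<sigma> s))"
proof -
  note ab = assms(1) and C = assms(4) and trivial = assms(5) and green = assms(6)
    and \<omega> = assms(7) and \<sigma> = assms(8) and det = assms(9)
  have ab': "a \<le> b" using ab by simp
  have n: "n > 0" using assms(2) by simp
  let ?A = "coupling_matrix \<delta> C \<omega>"
  let ?B = "matrix_inv (mat 1 - ?A)"
  let ?E = "\<lambda>j s. borel_ext a b (C j) (\<lambda>x. g x s)"
  define v where "v = (\<lambda>t. LBINT s:{a..b}. g t s * \<sigma> s)"
  have v: "solves n a b p M \<alpha> \<beta> \<sigma> (\<lambda>_. 0) v"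
    unfolding v_def by (rule green_solves[OF ab n green \<sigma>])
  have cont: "continuous_on {a..b} u" if "solves n a b p M \<alpha> \<beta> \<tau> \<gamma> u" for \<tau> \<gamma> u
    using that Cn_on_imp_continuous_on unfolding solves_def by blast
  note cont_v = cont[OF v] and cont_\<omega> = cont[OF \<omega>]
  note K = green_bounded_kernel[OF green n]
  note ext = borel_ext_Fubini[OF ab C K \<sigma> cont_v[unfolded v_def], folded v_def]
  \<comment> \<open>Equating this with \<open>C i v\<close> says that \<open>d $ i\<close> is the
    value of \<open>C i\<close> at \<open>v\<close> plus the sum of the
    \<open>\<delta> $ j * d $ j * \<omega> j\<close>.\<close>
  have fixpoint: "((mat 1 - ?A) *v d) $ i = d $ i - (\<Sum>j\<in>UNIV. \<delta> $ j * d $ j * C i (\<omega> j))" for d i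
  proof -
    have "(?A *v d) $ i = (\<Sum>j\<in>UNIV. \<delta> $ j * d $ j * C i (\<omega> j))"
      by (simp add: matrix_vector_mult_def coupling_matrix_def mult_ac)
    then show ?thesis by (simp add: matrix_vector_mult_diff_rdistrib)
  qed
  have C_lin: "C i (\<lambda>t. f t + (\<Sum>j\<in>UNIV. c j * \<omega> j t)) = C i f + (\<Sum>j\<in>UNIV. c j * C i (\<omega> j))"
    if "continuous_on {a..b} f" for i f and c :: "'n \<Rightarrow> real"
  proof -
    have "continuous_on {a..b} (\<lambda>t. \<Sum>j\<in>UNIV. c j * \<omega> j t)"
      using cont_\<omega> by (intro continuous_intros)
    then show ?thesis
      using cont_lin_functional_add[OF C that] cont_lin_functional_sum[OF C, where A = UNIV and f = \<omega> and c = c] cont_\<omega> by simp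
  qed
  define d where "d = ?B *v (\<chi> j. C j v)"
  define u where "u = (\<lambda>t. v t + (\<Sum>i\<in>UNIV. \<delta> $ i * d $ i * \<omega> i t))"
  have "(mat 1 - ?A) *v d = (\<chi> j. C j v)"
    unfolding d_def matrix_vector_mul_assoc matrix_inv_mult(1)[OF det] by simp
  then have "C i v = d $ i - (\<Sum>j\<in>UNIV. \<delta> $ j * d $ j * C i (\<omega> j))" for i
    using fixpoint[of d i] by simp
  \<comment> \<open>Consistency of the ansatz: the boundary values
    \<open>\<delta> $ i * d $ i\<close> of \<open>u\<close> are indeed
    \<open>\<delta> $ i * C i u\<close>.\<close>
  then have Cu: "C i u = d $ i" for i
    using C_lin[OF cont_v, where i = i and c = "\<lambda>j. \<delta> $ j * d $ j"] by (simp add: u_def)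
  have u: "solves n a b p M \<alpha> \<beta> \<sigma> (\<lambda>i. \<delta> $ i * C i u) u"
    using solves_lincomb[OF ab v, where I = UNIV and c = "\<lambda>j. \<delta> $ j * d $ j" and w = \<omega>, OF \<omega>]
    by (simp add: Cu if_distrib[of "\<lambda>x. _ * x"] cong: if_cong flip: u_def)
  have "w t = u t" if w: "solves n a b p M \<alpha> \<beta> \<sigma> (\<lambda>i. \<delta> $ i * C i w) w" and t: "t \<in> {a..b}" for w t
  proof -
    define z where "z = (\<lambda>t. w t - u t)"
    \<comment> \<open>The one-element index set with coefficient -1 expresses the difference of two
      solutions.\<close>
    have z: "solves n a b p M \<alpha> \<beta> (\<lambda>_. 0) (\<lambda>i. \<delta> $ i * C i z) z"
      using solves_lincomb[OF ab w, where I = "{()}" and c = "\<lambda>_. -1" and w = "\<lambda>_. u", OF u]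
        cont_lin_functional_diff[OF C cont[OF w] cont[OF u]]
      by (simp add: z_def right_diff_distrib)
    \<comment> \<open>Subtracting the \<omega> terms removes the boundary data of \<open>z\<close>,
      so \<open>?y\<close> solves the homogeneous problem and vanishes on the interval. Applying
      \<open>C i\<close> to it turns the vector of the \<open>C i z\<close> into a kernel vector of
      the invertible matrix.\<close>
    let ?y = "\<lambda>t. z t + (\<Sum>j\<in>UNIV. - (\<delta> $ j * C j z) * \<omega> j t)"
    have y: "solves n a b p M \<alpha> \<beta> (\<lambda>_. 0) (\<lambda>_. 0) ?y"
      using solves_lincomb[OF ab z, where I = UNIV and c = "\<lambda>j. - (\<delta> $ j * C j z)" and w = \<omega>, OF \<omega>]
      by (simp add: if_distrib[of "\<lambda>x. _ * x"] cong: if_cong)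
    have Cy: "C i ?y = 0" for i
      using cont_lin_functional_cong[OF ab' C cont[OF y], of "\<lambda>_. 0"] trivial[OF y]
        cont_lin_functional_scale[OF C, where f = "\<lambda>_. 0" and c = 0] by simp
    have Cz: "C i z - (\<Sum>j\<in>UNIV. \<delta> $ j * C j z * C i (\<omega> j)) = 0" for i
      using C_lin[OF cont[OF z], where i = i and c = "\<lambda>j. - (\<delta> $ j * C j z)"] Cy[of i]
      by (simp add: sum_negf)
    have "((mat 1 - ?A) *v (\<chi> i. C i z)) $ i = 0" for i
      using fixpoint[of "\<chi> i. C i z" i] Cz[of i] by simp
    then have "(mat 1 - ?A) *v (\<chi> i. C i z) = 0" by (simp add: vec_eq_iff)
    then have "?B *v ((mat 1 - ?A) *v (\<chi> i. C i z)) = 0" by simp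
    then have "(\<chi> i. C i z) = 0"
      unfolding matrix_vector_mul_assoc matrix_inv_mult(2)[OF det] by simp
    then have "C i z = 0" for i by (simp add: vec_eq_iff)
    \<comment> \<open>Once every \<open>C j z\<close> is 0, the function \<open>?y\<close> is
      \<open>z\<close> itself.\<close>
    then have "z t = 0" using trivial[OF y] t by simp
    then show ?thesis by (simp add: z_def)
  qed
  moreover have "set_integrable lborel {a..b} (\<lambda>s. nonlocal_green a b g \<delta> C \<omega> t s * \<sigma> s) \<and>
      u t = (LBINT s:{a..b}. nonlocal_green a b g \<delta> C \<omega> t s * \<sigma> s)" if t: "t \<in> {a..b}" for t
  proof -
    let ?c = "\<lambda>i j. \<delta> $ i * ?B $ i $ j * \<omega> i t"
    have "integrable lborel (\<lambda>s. indicator ({a..b} \<times> {a..b}) (t, s) * g t s * (indicator {a..b} s * \<sigma> s))"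
      by (rule bounded_kernel_slice_integrable[OF K continuous_on_bounded_cutoff(3)[OF \<sigma>]])
    also have "(\<lambda>s. indicator ({a..b} \<times> {a..b}) (t, s) * g t s * (indicator {a..b} s * \<sigma> s)) =
        (\<lambda>s. indicator {a..b} s *\<^sub>R (g t s * \<sigma> s))"
      using t by (auto simp: indicator_def fun_eq_iff)
    finally have g: "set_integrable lborel {a..b} (\<lambda>s. g t s * \<sigma> s)"
      by (simp add: set_integrable_def)
    have ind: "indicator {a..b} s *\<^sub>R (\<Sum>i\<in>UNIV. \<Sum>j\<in>UNIV. ?c i j * (?E j s * \<sigma> s)) =
        (\<Sum>i\<in>UNIV. \<Sum>j\<in>UNIV. ?c i j * (indicator {a..b} s *\<^sub>R (?E j s * \<sigma> s)))" for s
      by (cases "s \<in> {a..b}") simp_all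
    note ext_int = ext(1)[unfolded set_integrable_def]
    have E: "set_integrable lborel {a..b} (\<lambda>s. \<Sum>i\<in>UNIV. \<Sum>j\<in>UNIV. ?c i j * (?E j s * \<sigma> s))"
      unfolding set_integrable_def ind
      by (intro Bochner_Integration.integrable_sum integrable_mult_right ext_int)
    have eq: "nonlocal_green a b g \<delta> C \<omega> t s * \<sigma> s =
        g t s * \<sigma> s + (\<Sum>i\<in>UNIV. \<Sum>j\<in>UNIV. ?c i j * (?E j s * \<sigma> s))" for s
      by (simp add: nonlocal_green_def distrib_right sum_distrib_right mult.assoc)
    have "(LBINT s:{a..b}. nonlocal_green a b g \<delta> C \<omega> t s * \<sigma> s) =
        v t + (LBINT s:{a..b}. \<Sum>i\<in>UNIV. \<Sum>j\<in>UNIV. ?c i j * (?E j s * \<sigma> s))"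
      unfolding eq v_def by (rule set_integral_add[OF g E])
    also have "(LBINT s:{a..b}. \<Sum>i\<in>UNIV. \<Sum>j\<in>UNIV. ?c i j * (?E j s * \<sigma> s)) =
        (\<Sum>i\<in>UNIV. \<Sum>j\<in>UNIV. ?c i j * C j v)"
      unfolding set_lebesgue_integral_def ind ext(2)
      by (subst Bochner_Integration.integral_sum Bochner_Integration.integral_mult_right
          | intro Bochner_Integration.integrable_sum integrable_mult_right ext_int sum.cong refl)+
    \<comment> \<open>The inner sum over \<open>j\<close> is the \<open>i\<close>-th entry of
      \<open>?B\<close> applied to the vector of the \<open>C j v\<close>, which is
      \<open>d $ i\<close>.\<close>
    also have "\<dots> = (\<Sum>i\<in>UNIV. \<delta> $ i * d $ i * \<omega> i t)"
      by (simp add: d_def matrix_vector_mult_def sum_distrib_left sum_distrib_right mult_ac)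
    finally show ?thesis
      using set_integral_add(1)[OF g E] by (simp add: eq u_def)
  qed
  ultimately show ?thesis using u by blast
qed

end
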